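(* Let $d$ be an algebraic integer, $K=\mathbb{Q}(d)$, and let $f(x)\in\mathbb{Z}[x]$ be the minimal polynomial of $d$, of degree $n$. Suppose that $K/\mathbb{Q}$ is a Galois extension. Let $p$ be a prime number and $k=\mathbb{Z}/p\mathbb{Z}$. Write $$pO_K=(\mathfrak{P}_1\cdots\mathfrak{P}_g)^e,$$ where the $\mathfrak{P}_i$ are distinct prime ideals of $O_K$ with $h(\mathfrak{P}_i)=h$ for all $i=1,\dots,g$. Then $f$ factorizes modulo $p$ as $$\bar f(x)=(f_1\cdots f_g)^e \pmod p,$$ where $f_i\in k[x]$ with $\deg f_i=h$ for all $i$, and each $f_i$ is of the form $f_i=g_i^{e_i'}$ for some irreducible $g_i\in k[x]$ and some integer $e_i'\ge 1$.
   Context: $O_K$ denotes the ring of algebraic integers contained in $K$. For a prime ideal $\mathfrak{P}$ of $O_K$ with $\mathfrak{P}\cap\mathbb{Z}=p\mathbb{Z}$, $h(\mathfrak{P})=[O_K/\mathfrak{P}:\mathbb{Z}/p\mathbb{Z}]$ is the residue degree of $\mathfrak{P}$. (For $K/\mathbb{Q}$ Galois, all primes above $p$ have the same ramification index $e$ and residue degree $h$, and $n=ehg$.) $\bar f$ denotes the reduction of $f$ modulo $p$. *)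

theory Defs
  imports "Berlekamp_Zassenhaus.Finite_Field" "HOL-Algebra.Ideal_Product" "HOL-Algebra.QuotRing"
begin

definition num_field :: "complex \<Rightarrow> complex set" where
  "num_field d = {x. \<exists>a b :: rat poly. poly (map_poly of_rat b) d \<noteq> 0 \<and>
        x = poly (map_poly of_rat a) d / poly (map_poly of_rat b) d}"

definition ring_of_integers :: "complex set \<Rightarrow> complex set" where
  "ring_of_integers K = {x \<in> K. algebraic_int x}"

definition OK_ring :: "complex set \<Rightarrow> complex ring" where
  "OK_ring K = \<lparr>carrier = ring_of_integers K, monoid.mult = (*), one = 1,
                 zero = 0, add = (+)\<rparr>"

text \<open>K/Q is Galois (normal; separability is automatic in characteristic 0):
every irreducible rational polynomial having a root in K splits into linear
factors over K, i.e. all its complex roots lie in K.\<close>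
definition galois_over_Q :: "complex set \<Rightarrow> bool" where
  "galois_over_Q K \<longleftrightarrow> (\<forall>q :: rat poly. irreducible q \<longrightarrow>
      (\<exists>x\<in>K. poly (map_poly of_rat q) x = 0) \<longrightarrow>
      (\<forall>y. poly (map_poly of_rat q) y = 0 \<longrightarrow> y \<in> K))"

definition is_min_poly :: "complex \<Rightarrow> int poly \<Rightarrow> bool" where
  "is_min_poly d f \<longleftrightarrow> lead_coeff f = 1 \<and> irreducible (map_poly of_int f :: rat poly)
      \<and> poly (map_poly of_int f) d = 0"

fun ideal_prod_list :: "('a, 'b) ring_scheme \<Rightarrow> (nat \<Rightarrow> 'a set) \<Rightarrow> nat \<Rightarrow> 'a set" where
  "ideal_prod_list R P 0 = carrier R"
| "ideal_prod_list R P (Suc g) = ideal_prod R (ideal_prod_list R P g) (P g)"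

fun ideal_pow :: "('a, 'b) ring_scheme \<Rightarrow> 'a set \<Rightarrow> nat \<Rightarrow> 'a set" where
  "ideal_pow R I 0 = carrier R"
| "ideal_pow R I (Suc e) = ideal_prod R (ideal_pow R I e) I"

text \<open>Residue degree h(P) = [O_K/P : Z/pZ], expressed as |O_K/P| = p^h.\<close>
definition has_residue_degree :: "('a, 'b) ring_scheme \<Rightarrow> 'a set \<Rightarrow> nat \<Rightarrow> nat \<Rightarrow> bool" where
  "has_residue_degree R P p h \<longleftrightarrow> card (carrier (R Quot P)) = p ^ h"

end

theory Submission
  imports Defs "Jordan_Normal_Form.Char_Poly"
    "HOL-Computational_Algebra.Fundamental_Theorem_Algebra"
    "HOL-Computational_Algebra.Field_as_Ring"
begin

text \<open>Write A for the order generated by d, R for the ring of integers, and g_i for the minimal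
  polynomial over k of the residue class of d modulo the i-th prime. The claim is that f modulo p is the
  product of the powers g_i^(e h / deg g_i), and it suffices to compare the multiplicities of a monic
  irreducible q on both sides. Localize at the complement S of the prime ideal (p, q(d)) of A and
  compute the index of pM in M for two modules M. For M the localization of A, the quotient is
  k[x]/(q^m) with m the multiplicity of q in f modulo p, so the index is p^(m deg q). For M the
  localization of R, the factorization of pR gives a filtration whose quotients are localizations
  of the residue fields of the given primes; these vanish unless q = g_i, so the index is p^(e h c)
  where c counts the i with g_i = q. Both indices agree because A has finite index in R.\<close>

section \<open>Indices of additive subgroups\<close>

text \<open>The obstacle is that p may divide the index of A in R. Then A/pA -> R/pR is not
  injective, and the factors of f modulo p cannot be matched one by one with the primes of R:
  several primes may induce the same g_i, and deg g_i may be smaller than h. An index is insensitive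
  to this defect, since the index of cM in M does not change when M is replaced by a subgroup of
  finite index that is stable under c. The indices of pA in A and of pR in R only give p^n, that is,
  the degree of f; localizing at one q at a time recovers the multiplicity m of q. Equality of the
  powers of p reads m deg q = e h c, and deg q divides h whenever q is some g_i. No theory of
  Dedekind domains is needed: every ideal of the filtration divides (p) by the given factorization,
  and this alone makes it invertible.\<close>

definition add_subgroup :: "'a::ab_group_add set \<Rightarrow> bool" where
  "add_subgroup M \<longleftrightarrow> 0 \<in> M \<and> (\<forall>x\<in>M. \<forall>y\<in>M. x - y \<in> M)"

definition cosets :: "'a::ab_group_add set \<Rightarrow> 'a set \<Rightarrow> 'a set set" where
  "cosets M N = (\<lambda>x. {y. y - x \<in> N}) ` M"

text \<open>By the convention of \<open>card\<close> an infinite index is 0. The tower law then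
  holds without finiteness assumptions, and finiteness of an index becomes the statement that it is
  nonzero.\<close>

definition sub_index :: "'a::ab_group_add set \<Rightarrow> 'a set \<Rightarrow> nat" where
  "sub_index M N = card (cosets M N)"

lemma add_subgroup_zero: "add_subgroup M \<Longrightarrow> 0 \<in> M"
  and add_subgroup_diff: "add_subgroup M \<Longrightarrow> x \<in> M \<Longrightarrow> y \<in> M \<Longrightarrow> x - y \<in> M"
  by (auto simp: add_subgroup_def)

lemma add_subgroup_minus: "add_subgroup M \<Longrightarrow> x \<in> M \<Longrightarrow> - x \<in> M"
  using add_subgroup_diff[of M 0 x] add_subgroup_zero[of M] by simp

lemma add_subgroup_add: "add_subgroup M \<Longrightarrow> x \<in> M \<Longrightarrow> y \<in> M \<Longrightarrow> x + y \<in> M"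
  using add_subgroup_diff[of M x "- y"] add_subgroup_minus[of M y] by simp

lemma add_subgroup_diff_commute: "add_subgroup M \<Longrightarrow> x - y \<in> M \<longleftrightarrow> y - x \<in> M"
  using add_subgroup_minus[of M "x - y"] add_subgroup_minus[of M "y - x"] by auto

lemma add_subgroup_mult_image:
  fixes M :: "'a::ring set"
  assumes "add_subgroup M"
  shows "add_subgroup ((*) c ` M)"
  unfolding add_subgroup_def
proof (intro conjI ballI)
  show "0 \<in> (*) c ` M"
    using add_subgroup_zero[OF assms] by (force simp: image_iff)
next
  fix x y assume "x \<in> (*) c ` M" "y \<in> (*) c ` M"
  then obtain u v where "x = c * u" "u \<in> M" "y = c * v" "v \<in> M" by auto
  then have "x - y = c * (u - v)" "u - v \<in> M"
    using add_subgroup_diff[OF assms] by (auto simp: right_diff_distrib)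
  then show "x - y \<in> (*) c ` M" by blast
qed

lemma coset_eq_iff:
  assumes "add_subgroup N"
  shows "{z. z - x \<in> N} = {z. z - y \<in> N} \<longleftrightarrow> x - y \<in> N"
proof
  assume "{z. z - x \<in> N} = {z. z - y \<in> N}"
  moreover have "x \<in> {z. z - x \<in> N}" using add_subgroup_zero[OF assms] by simp
  ultimately have "x \<in> {z. z - y \<in> N}" by simp
  then show "x - y \<in> N" by simp
next
  assume xy: "x - y \<in> N"
  have "z - x \<in> N \<longleftrightarrow> z - y \<in> N" for z
    using add_subgroup_add[OF assms, of "z - x" "x - y"]
      add_subgroup_diff[OF assms, of "z - y" "x - y"] xy by auto
  then show "{z. z - x \<in> N} = {z. z - y \<in> N}" by auto
qed

lemma bij_betw_images_same_kernel:
  assumes "\<And>x y. x \<in> X \<Longrightarrow> y \<in> X \<Longrightarrow> F x = F y \<longleftrightarrow> G x = G y"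
  shows "\<exists>k. bij_betw k (F ` X) (G ` X)"
proof
  have inv: "inv_into X F (F x) \<in> X" "F (inv_into X F (F x)) = F x" if "x \<in> X" for x
    using that by (auto intro: inv_into_into f_inv_into_f)
  have G: "G (inv_into X F (F x)) = G x" if "x \<in> X" for x
    using assms inv[OF that] that by blast
  show "bij_betw (\<lambda>z. G (inv_into X F z)) (F ` X) (G ` X)"
  proof (rule bij_betw_imageI)
    show "inj_on (\<lambda>z. G (inv_into X F z)) (F ` X)"
      by (rule inj_onI) (auto simp: G assms)
    show "(\<lambda>z. G (inv_into X F z)) ` F ` X = G ` X"
      unfolding image_image by (rule image_cong) (simp_all add: G)
  qed
qed

lemma cosets_parametrize:
  assumes N: "add_subgroup N" and X: "\<phi> ` X \<subseteq> M"
    and surj: "\<And>z. z \<in> M \<Longrightarrow> \<exists>x\<in>X. z - \<phi> x \<in> N"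
  shows "cosets M N = (\<lambda>x. {z. z - \<phi> x \<in> N}) ` X"
  unfolding cosets_def
proof (intro equalityI subsetI)
  fix K assume "K \<in> (\<lambda>x. {z. z - x \<in> N}) ` M"
  then obtain z where z: "z \<in> M" "K = {y. y - z \<in> N}" by blast
  then obtain x where "x \<in> X" "z - \<phi> x \<in> N" using surj by blast
  moreover from this have "K = {y. y - \<phi> x \<in> N}"
    by (simp add: z(2) coset_eq_iff[OF N])
  ultimately show "K \<in> (\<lambda>x. {z. z - \<phi> x \<in> N}) ` X" by blast
qed (use X in blast)

text \<open>The counting principle behind the index computations: \<phi> parametrizes M up to N, and
  \<psi> is an invariant that separates exactly the classes. Neither map has to be a homomorphism,
  so the remainder modulo a polynomial may serve as \<psi>.\<close>

lemma sub_index_eq_card: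
  assumes N: "add_subgroup N" and X: "\<phi> ` X \<subseteq> M"
    and surj: "\<And>z. z \<in> M \<Longrightarrow> \<exists>x\<in>X. z - \<phi> x \<in> N"
    and ker: "\<And>x y. x \<in> X \<Longrightarrow> y \<in> X \<Longrightarrow> \<phi> x - \<phi> y \<in> N \<longleftrightarrow> \<psi> x = \<psi> y"
  shows "sub_index M N = card (\<psi> ` X)"
proof -
  obtain k where "bij_betw k ((\<lambda>x. {z. z - \<phi> x \<in> N}) ` X) (\<psi> ` X)"
    using bij_betw_images_same_kernel[of X "\<lambda>x. {z. z - \<phi> x \<in> N}" \<psi>] ker
    unfolding coset_eq_iff[OF N] by metis
  then show ?thesis
    unfolding sub_index_def cosets_parametrize[OF N X surj, simplified] by (rule bij_betw_same_card)
qed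

text \<open>Cardinality form of an isomorphism M'/N' -> M/N induced by \<phi>.\<close>

lemma sub_index_eq_sub_index:
  assumes N: "add_subgroup N" and N': "add_subgroup N'" and X: "\<phi> ` M' \<subseteq> M"
    and surj: "\<And>z. z \<in> M \<Longrightarrow> \<exists>x\<in>M'. z - \<phi> x \<in> N"
    and ker: "\<And>x y. x \<in> M' \<Longrightarrow> y \<in> M' \<Longrightarrow> \<phi> x - \<phi> y \<in> N \<longleftrightarrow> x - y \<in> N'"
  shows "sub_index M N = sub_index M' N'"
  unfolding sub_index_def[of M' N'] cosets_def[of M' N']
  by (rule sub_index_eq_card[OF N X surj]) (simp_all add: ker coset_eq_iff[OF N'])

text \<open>The class of x modulo N corresponds to a pair: the coset of x modulo L, and the class
  modulo N of the difference between x and a chosen representative of that coset. The representative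
  \<open>r x\<close> depends on the coset only.\<close>

lemma sub_index_tower:
  assumes M: "add_subgroup M" and L: "add_subgroup L" and N: "add_subgroup N"
    and "N \<subseteq> L" "L \<subseteq> M"
  shows "sub_index M N = sub_index M L * sub_index L N"
proof -
  define C where "C = (\<lambda>x. {y. y - x \<in> L})"
  define D where "D = (\<lambda>x. {y. y - x \<in> N})"
  define r where "r = (\<lambda>x. inv_into M C (C x))"
  have r: "r x \<in> M" "x - r x \<in> L" if "x \<in> M" for x
  proof -
    show "r x \<in> M" using that by (simp add: r_def inv_into_into)
    have "C (r x) = C x" using that by (simp add: r_def f_inv_into_f)
    then have "r x - x \<in> L" by (simp add: C_def coset_eq_iff[OF L])
    then show "x - r x \<in> L" using add_subgroup_diff_commute[OF L] by blast
  qed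
  have r_eq: "r x = r y \<longleftrightarrow> x - y \<in> L" if "x \<in> M" "y \<in> M" for x y
  proof
    assume "r x = r y"
    then have "x - y = (x - r x) - (y - r y)" by simp
    then show "x - y \<in> L" using add_subgroup_diff[OF L] r that by metis
  next
    assume "x - y \<in> L"
    then have "C x = C y" by (simp add: C_def coset_eq_iff[OF L])
    then show "r x = r y" by (simp add: r_def)
  qed
  let ?\<psi> = "\<lambda>x. (C x, D (x - r x))"
  have "sub_index M N = card (?\<psi> ` M)"
  proof (rule sub_index_eq_card[OF N, where \<phi> = "\<lambda>x. x"])
    fix z assume "z \<in> M"
    then show "\<exists>x\<in>M. z - x \<in> N" using add_subgroup_zero[OF N] by (intro bexI[of _ z]) auto
  next
    fix x y assume xy: "x \<in> M" "y \<in> M"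
    have "C x = C y \<longleftrightarrow> x - y \<in> L" unfolding C_def by (rule coset_eq_iff[OF L])
    moreover have "D (x - r x) = D (y - r y) \<longleftrightarrow> (x - r x) - (y - r y) \<in> N"
      unfolding D_def by (rule coset_eq_iff[OF N])
    ultimately show "x - y \<in> N \<longleftrightarrow> ?\<psi> x = ?\<psi> y"
      using r_eq[OF xy] \<open>N \<subseteq> L\<close> by auto
  qed auto
  also have "?\<psi> ` M = (C ` M) \<times> (D ` L)"
  proof (intro equalityI subsetI)
    fix z assume "z \<in> (C ` M) \<times> (D ` L)"
    then obtain x l where z: "z = (C x, D l)" "x \<in> M" "l \<in> L" by auto
    define y where "y = r x + l"
    have "r x - x \<in> L" using add_subgroup_diff_commute[OF L] r(2)[OF z(2)] by blast
    then have "r x - x + l \<in> L" using add_subgroup_add[OF L] z(3) by blast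
    then have yx: "y - x \<in> L" by (simp add: y_def algebra_simps)
    have y: "y \<in> M" unfolding y_def
      using add_subgroup_add[OF M] r(1) z \<open>L \<subseteq> M\<close> by blast
    have "r y = r x" using r_eq[OF y z(2)] yx by blast
    moreover have "C y = C x" by (simp add: C_def coset_eq_iff[OF L] yx)
    ultimately have "?\<psi> y = z" by (simp add: z(1) y_def)
    then show "z \<in> ?\<psi> ` M" using y by blast
  qed (use r in auto)
  finally show ?thesis
    by (simp add: card_cartesian_product sub_index_def cosets_def C_def D_def)
qed

lemma sub_index_nonzero_iff: "M \<noteq> {} \<Longrightarrow> sub_index M N \<noteq> 0 \<longleftrightarrow> finite (cosets M N)"
  by (simp add: sub_index_def card_eq_0_iff) (simp add: cosets_def)

lemma sub_index_self:
  assumes "add_subgroup M"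
  shows "sub_index M M = 1"
proof -
  have "sub_index M M = card ((\<lambda>_. 0::nat) ` M)"
  proof (rule sub_index_eq_card[OF assms, where \<phi> = "\<lambda>x. x"])
    fix z assume "z \<in> M"
    then show "\<exists>x\<in>M. z - x \<in> M" using add_subgroup_zero[OF assms] by (intro bexI[of _ z]) auto
  qed (simp_all add: add_subgroup_diff[OF assms])
  moreover have "(\<lambda>_. 0::nat) ` M = {0}"
    using add_subgroup_zero[OF assms] by (rule image_constant)
  ultimately show ?thesis by simp
qed

lemma sub_index_mult_image:
  fixes M :: "'a::idom set"
  assumes N: "add_subgroup N" and "c \<noteq> 0"
  shows "sub_index ((*) c ` M) ((*) c ` N) = sub_index M N"
proof (rule sub_index_eq_sub_index[OF add_subgroup_mult_image[OF N] N, where \<phi> = "(*) c"])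
  fix z assume "z \<in> (*) c ` M"
  then show "\<exists>x\<in>M. z - c * x \<in> (*) c ` N"
    using add_subgroup_zero[OF N] by (force simp: image_iff)
next
  fix x y
  have "c * x - c * y = c * (x - y)" by (simp add: right_diff_distrib)
  then show "c * x - c * y \<in> (*) c ` N \<longleftrightarrow> x - y \<in> N"
    using \<open>c \<noteq> 0\<close> by (auto simp: image_iff)
qed auto

text \<open>Both sides complete the index of N in M, respectively of cN in cM, to the index of cN in M.\<close>
lemma sub_index_mult_image_commensurable:
  fixes M :: "'a::idom set"
  assumes M: "add_subgroup M" and N: "add_subgroup N" and "N \<subseteq> M"
    and fin: "finite (cosets M N)" and "c \<noteq> 0" and "(*) c ` M \<subseteq> M" "(*) c ` N \<subseteq> N"
  shows "sub_index M ((*) c ` M) = sub_index N ((*) c ` N)"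
proof -
  note sub = M N add_subgroup_mult_image[OF M, of c] add_subgroup_mult_image[OF N, of c]
  have "sub_index M N * sub_index N ((*) c ` N) = sub_index M ((*) c ` N)"
    using sub_index_tower[of M N "(*) c ` N"] assms sub by simp
  also have "\<dots> = sub_index M ((*) c ` M) * sub_index ((*) c ` M) ((*) c ` N)"
    using sub_index_tower[of M "(*) c ` M" "(*) c ` N"] assms sub by blast
  also have "sub_index ((*) c ` M) ((*) c ` N) = sub_index M N"
    by (rule sub_index_mult_image[OF N \<open>c \<noteq> 0\<close>])
  finally show ?thesis
    using sub_index_nonzero_iff[of M N] fin add_subgroup_zero[OF M]
    by (metis empty_iff mult.commute mult_cancel_left)
qed

section \<open>Localization at a submonoid\<close>

definition submonoid_mult :: "'a::comm_ring_1 set \<Rightarrow> bool" where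
  "submonoid_mult S \<longleftrightarrow> 1 \<in> S \<and> (\<forall>s\<in>S. \<forall>t\<in>S. s * t \<in> S)"

definition stable_under :: "'a::comm_ring_1 set \<Rightarrow> 'a set \<Rightarrow> bool" where
  "stable_under S M \<longleftrightarrow> (\<forall>s\<in>S. \<forall>x\<in>M. s * x \<in> M)"

text \<open>The localization is taken inside the ambient ring, without forming fractions: in a field
  and for S without 0 this is the set of quotients of elements of M by elements of S. If 0 lies in S
  and in M, it is the whole ambient ring.\<close>

definition loc :: "'a::comm_ring_1 set \<Rightarrow> 'a set \<Rightarrow> 'a set" where
  "loc S M = {x. \<exists>s\<in>S. s * x \<in> M}"

lemma stable_underD: "stable_under S M \<Longrightarrow> s \<in> S \<Longrightarrow> x \<in> M \<Longrightarrow> s * x \<in> M"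
  by (auto simp: stable_under_def)

lemma subset_loc: "submonoid_mult S \<Longrightarrow> M \<subseteq> loc S M"
  by (force simp: submonoid_mult_def loc_def)

lemma loc_mono: "M \<subseteq> N \<Longrightarrow> loc S M \<subseteq> loc S N"
  by (auto simp: loc_def)

lemma loc_cancel:
  assumes "submonoid_mult S" "s \<in> S" "s * x \<in> loc S M"
  shows "x \<in> loc S M"
proof -
  from assms(3) obtain t where "t \<in> S" "t * (s * x) \<in> M" by (auto simp: loc_def)
  then show ?thesis
    using assms(1,2) by (auto simp: loc_def submonoid_mult_def mult.assoc[symmetric])
qed

lemma add_subgroup_loc:
  assumes "submonoid_mult S" "stable_under S M" "add_subgroup M"
  shows "add_subgroup (loc S M)"
  unfolding add_subgroup_def
proof (intro conjI ballI)
  show "0 \<in> loc S M"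
    using subset_loc[OF assms(1)] add_subgroup_zero[OF assms(3)] by blast
next
  fix x y assume "x \<in> loc S M" "y \<in> loc S M"
  then obtain s t where s: "s \<in> S" "s * x \<in> M" and t: "t \<in> S" "t * y \<in> M"
    by (auto simp: loc_def)
  have "t * (s * x) \<in> M" "s * (t * y) \<in> M"
    using stable_underD[OF assms(2)] s t by auto
  then have "t * (s * x) - s * (t * y) \<in> M" by (rule add_subgroup_diff[OF assms(3)])
  then have "(s * t) * (x - y) \<in> M" by (simp add: algebra_simps)
  then show "x - y \<in> loc S M"
    using assms(1) s t by (auto simp: loc_def submonoid_mult_def)
qed

lemma loc_mult_image:
  fixes M :: "'a::field set"
  assumes "c \<noteq> 0"
  shows "loc S ((*) c ` M) = (*) c ` loc S M"
proof (intro equalityI subsetI)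
  fix x assume "x \<in> loc S ((*) c ` M)"
  then obtain s m where "s \<in> S" "m \<in> M" "s * x = c * m" by (auto simp: loc_def)
  then have "s * (x / c) = m" using assms by (simp add: field_simps)
  then have "x / c \<in> loc S M" using \<open>s \<in> S\<close> \<open>m \<in> M\<close> by (auto simp: loc_def)
  moreover have "x = c * (x / c)" using assms by simp
  ultimately show "x \<in> (*) c ` loc S M" by blast
next
  fix x assume "x \<in> (*) c ` loc S M"
  then obtain y s where "x = c * y" "s \<in> S" "s * y \<in> M" by (auto simp: loc_def)
  then show "x \<in> loc S ((*) c ` M)" by (auto simp: loc_def image_iff mult.left_commute)
qed

text \<open>Every s in S acts on the finite group M/N with eventually periodic powers, so division
  by s does not leave the image of M.\<close>
lemma finite_cosets_loc:
  assumes S: "submonoid_mult S" and M: "stable_under S M"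
    and N: "add_subgroup N" "stable_under S N" and fin: "finite (cosets M N)"
  shows "finite (cosets (loc S M) (loc S N))"
proof -
  have N': "add_subgroup (loc S N)" by (rule add_subgroup_loc[OF S N(2,1)])
  have "cosets (loc S M) (loc S N) = (\<lambda>x. {z. z - x \<in> loc S N}) ` M"
  proof (rule cosets_parametrize[OF N'])
    fix z assume "z \<in> loc S M"
    then obtain s where s: "s \<in> S" "s * z \<in> M" by (auto simp: loc_def)
    define y where "y = s * z"
    have powS: "s ^ k \<in> S" for k
      using S s(1) by (induction k) (auto simp: submonoid_mult_def)
    have y: "s ^ k * y \<in> M" for k
      using stable_underD[OF M powS[of k]] s(2) by (simp add: y_def)
    define F where "F = (\<lambda>k. {x. x - s ^ k * y \<in> N})"
    have "F ` UNIV \<subseteq> cosets M N" unfolding F_def cosets_def using y by blast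
    then have "finite (range F)" using fin finite_subset by blast
    then have "\<not> inj F" using finite_imageD by fastforce
    then obtain i j where "F i = F j" "i < j" unfolding inj_def by (metis nat_neq_iff)
    then have ij: "s ^ i * y - s ^ j * y \<in> N"
      by (simp add: F_def coset_eq_iff[OF N(1)])
    \<comment> \<open>Modulo N, s^i y and s^j y agree. Since y = s z, dividing by s^(i+1) turns s^i
      y into z and s^j y into s^(j-i-1) y, and this exponent is a natural number because i <
      j.\<close>
    define b where "b = s ^ (j - Suc i) * y"
    have "s ^ j = s ^ Suc i * s ^ (j - Suc i)"
      unfolding power_add[symmetric] using \<open>i < j\<close> by simp
    then have "s ^ Suc i * (z - b) = s ^ i * y - s ^ j * y"
      by (simp add: b_def y_def algebra_simps)
    with ij have "s ^ Suc i * (z - b) \<in> N" by (simp only:)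
    then have "z - b \<in> loc S N" using powS[of "Suc i"] unfolding loc_def by blast
    then show "\<exists>x\<in>M. z - x \<in> loc S N" using y b_def by blast
  qed (use subset_loc[OF S] in auto)
  also have "finite \<dots>"
  proof -
    \<comment> \<open>The class modulo \<open>loc S N\<close> of an element of M depends only on its
      class modulo N, so the finite set of the latter maps onto the set of the former.\<close>
    have "{z. z - x \<in> loc S N} = {z. z - y \<in> loc S N}"
      if "{z. z - x \<in> N} = {z. z - y \<in> N}" for x y
      using that subset_loc[OF S, of N]
      unfolding coset_eq_iff[OF N(1)] coset_eq_iff[OF N'] by (rule subsetD[rotated])
    then have "(\<lambda>x. {z. z - x \<in> loc S N}) ` M =
        (\<lambda>K. {z. z - (SOME x. K = {z. z - x \<in> N}) \<in> loc S N}) ` cosets M N"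
      unfolding cosets_def image_image by (intro image_cong refl) (rule someI2, rule refl, blast)
    then show ?thesis using fin by simp
  qed
  finally show ?thesis .
qed

section \<open>Algebraic integers form a ring\<close>

definition zspan :: "'a::comm_ring_1 set \<Rightarrow> 'a set" where
  "zspan B = range (\<lambda>c. \<Sum>b\<in>B. of_int (c b) * b)"

lemma zspan_base: "finite B \<Longrightarrow> b \<in> B \<Longrightarrow> b \<in> zspan B"
  unfolding zspan_def
  by (rule range_eqI[of _ _ "\<lambda>x. if x = b then 1 else 0"]) (simp add: if_distrib if_distribR cong: if_cong)

lemma zspan_add:
  assumes "x \<in> zspan B" "y \<in> zspan B"
  shows "x + y \<in> zspan B"
proof -
  from assms obtain c c' where "x = (\<Sum>b\<in>B. of_int (c b) * b)" "y = (\<Sum>b\<in>B. of_int (c' b) * b)"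
    by (auto simp: zspan_def)
  then have "x + y = (\<Sum>b\<in>B. of_int (c b + c' b) * b)"
    by (simp add: sum.distrib distrib_right)
  then show ?thesis unfolding zspan_def by (rule range_eqI[where x = "\<lambda>b. c b + c' b"])
qed

lemma zspan_of_int_mult:
  assumes "x \<in> zspan B"
  shows "of_int k * x \<in> zspan B"
proof -
  from assms obtain c where "x = (\<Sum>b\<in>B. of_int (c b) * b)" by (auto simp: zspan_def)
  then have "of_int k * x = (\<Sum>b\<in>B. of_int (k * c b) * b)"
    by (simp add: sum_distrib_left mult.assoc)
  then show ?thesis unfolding zspan_def by (rule range_eqI[where x = "\<lambda>b. k * c b"])
qed

lemma zspan_sum: "(\<And>i. i \<in> I \<Longrightarrow> w i \<in> zspan B) \<Longrightarrow> (\<Sum>i\<in>I. w i) \<in> zspan B"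
proof (induction I rule: infinite_finite_induct)
  case empty
  have "(\<Sum>b\<in>B. of_int 0 * b) \<in> zspan B" unfolding zspan_def by (rule rangeI)
  then show ?case by simp
next
  case (infinite I)
  have "(\<Sum>b\<in>B. of_int 0 * b) \<in> zspan B" unfolding zspan_def by (rule rangeI)
  then show ?case using infinite by simp
qed (simp add: zspan_add)

lemma zspan_mult_closed:
  assumes "\<And>b. b \<in> B \<Longrightarrow> a * b \<in> zspan B" "x \<in> zspan B"
  shows "a * x \<in> zspan B"
proof -
  from assms(2) obtain c where "x = (\<Sum>b\<in>B. of_int (c b) * b)" by (auto simp: zspan_def)
  then have "a * x = (\<Sum>b\<in>B. of_int (c b) * (a * b))"
    by (simp add: sum_distrib_left mult.left_commute)
  also have "\<dots> \<in> zspan B" using assms(1) by (intro zspan_sum zspan_of_int_mult)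
  finally show ?thesis .
qed

text \<open>The Cayley-Hamilton criterion: x is an eigenvalue of the integer matrix describing the
  multiplication by x on B, hence a root of its characteristic polynomial.\<close>
lemma algebraic_int_if_zspan_stable:
  fixes x :: "'a::field_char_0"
  assumes fin: "finite B" and v: "v \<in> B" "v \<noteq> 0"
    and stable: "\<And>b. b \<in> B \<Longrightarrow> x * b \<in> zspan B"
  shows "algebraic_int x"
proof -
  obtain e where e: "bij_betw e {0..<card B} B" using ex_bij_betw_nat_finite[OF fin] by blast
  define N where "N = card B"
  note e = e[folded N_def]
  obtain c where c: "\<And>b. b \<in> B \<Longrightarrow> x * b = (\<Sum>b'\<in>B. of_int (c b b') * b')"
    using stable unfolding zspan_def image_iff by metis
  have eB: "e i \<in> B" if "i < N" for i using bij_betwE[OF e] that by auto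
  define A :: "int mat" where "A = mat N N (\<lambda>(i, j). c (e i) (e j))"
  define w where "w = vec N e"
  let ?A = "map_mat of_int A :: 'a mat"
  have A: "A \<in> carrier_mat N N" and A': "?A \<in> carrier_mat N N" by (auto simp: A_def)
  have "?A *\<^sub>v w = x \<cdot>\<^sub>v w"
  proof (rule eq_vecI)
    fix i assume "i < dim_vec (x \<cdot>\<^sub>v w)"
    then have i: "i < N" by (simp add: w_def)
    have "(?A *\<^sub>v w) $ i = (\<Sum>j\<in>{0..<N}. of_int (c (e i) (e j)) * e j)"
      using i by (simp add: A_def w_def scalar_prod_def)
    also have "\<dots> = (\<Sum>b'\<in>B. of_int (c (e i) b') * b')"
      by (rule sum.reindex_bij_betw[OF e])
    also have "\<dots> = x * e i" using c[OF eB[OF i]] by simp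
    finally show "(?A *\<^sub>v w) $ i = (x \<cdot>\<^sub>v w) $ i" using i by (simp add: w_def)
  qed (simp add: A_def w_def)
  moreover have "w \<noteq> 0\<^sub>v N"
  proof
    assume w0: "w = 0\<^sub>v N"
    obtain i where "i < N" "v = e i" using e v(1) unfolding bij_betw_def by auto
    moreover have "w $ i = 0\<^sub>v N $ i" using w0 by simp
    ultimately show False using v(2) by (simp add: w_def)
  qed
  ultimately have "eigenvector ?A w x"
    unfolding eigenvector_def using A' by (simp add: w_def)
  then have "eigenvalue ?A x" unfolding eigenvalue_def by blast
  then have "poly (char_poly ?A) x = 0" using eigenvalue_root_char_poly[OF A'] by blast
  then have "poly (map_poly of_int (char_poly A)) x = 0"
    by (simp add: of_int_hom.char_poly_hom[OF A])
  moreover have "lead_coeff (char_poly A) = 1" using degree_monic_char_poly[OF A] by simp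
  ultimately show ?thesis unfolding algebraic_int_altdef_ipoly by blast
qed

lemma algebraic_int_power_eq:
  fixes a :: "'a::field_char_0"
  assumes "algebraic_int a"
  obtains n c where "0 < n" "a ^ n = (\<Sum>i<n. of_int (c i) * a ^ i)"
proof -
  obtain p where p: "poly (map_poly of_int p) a = 0" "lead_coeff p = 1"
    using assms unfolding algebraic_int_altdef_ipoly by blast
  have "degree p \<noteq> 0"
  proof
    assume "degree p = 0"
    with p(2) have "p = 1" using monic_degree_0 by blast
    with p(1) show False by simp
  qed
  have "0 = (\<Sum>i\<le>degree p. of_int (coeff p i) * a ^ i)"
    using p(1) by (simp add: poly_altdef)
  also have "\<dots> = (\<Sum>i<degree p. of_int (coeff p i) * a ^ i) + a ^ degree p"
    using p(2) by (simp add: lessThan_Suc_atMost[symmetric])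
  finally have "a ^ degree p = (\<Sum>i<degree p. of_int (- coeff p i) * a ^ i)"
    by (simp add: sum_negf eq_neg_iff_add_eq_0 add.commute)
  then show ?thesis using that[of "degree p" "\<lambda>i. - coeff p i"] \<open>degree p \<noteq> 0\<close> by blast
qed

text \<open>The monomials a^i b^j with i < n and j < m span Z[a, b]: a factor that raises an
  exponent to n or m is rewritten by the monic equation of a or b. The span is therefore stable
  under a + b and a b, and it contains 1 as the required nonzero generator.\<close>

lemma algebraic_int_add_times:
  fixes a b :: "'a::field_char_0"
  assumes "algebraic_int a" "algebraic_int b"
  shows "algebraic_int (a + b)" "algebraic_int (a * b)"
proof -
  obtain n c where n: "0 < n" "a ^ n = (\<Sum>i<n. of_int (c i) * a ^ i)"
    using algebraic_int_power_eq[OF assms(1)] by blast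
  obtain m c' where m: "0 < m" "b ^ m = (\<Sum>i<m. of_int (c' i) * b ^ i)"
    using algebraic_int_power_eq[OF assms(2)] by blast
  define B where "B = (\<lambda>(i, j). a ^ i * b ^ j) ` ({..<n} \<times> {..<m})"
  have fin: "finite B" by (simp add: B_def)
  have mem: "a ^ i * b ^ j \<in> zspan B" if "i < n" "j < m" for i j
    using that by (intro zspan_base[OF fin]) (auto simp: B_def)
  have one: "1 \<in> B" using n(1) m(1) by (force simp: B_def)
  have a: "a * x \<in> zspan B" if x: "x \<in> B" for x
  proof -
    obtain i j where ij: "x = a ^ i * b ^ j" "i < n" "j < m" using x by (auto simp: B_def)
    show ?thesis
    proof (cases "Suc i < n")
      case True
      then show ?thesis using mem[OF True ij(3)] by (simp add: ij(1) mult.assoc)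
    next
      case False
      then have "n = Suc i" using ij by simp
      then have "a * x = a ^ n * b ^ j" by (simp add: ij(1) mult.assoc)
      also have "\<dots> = (\<Sum>k<n. of_int (c k) * (a ^ k * b ^ j))"
        by (simp add: n(2) sum_distrib_right mult.assoc)
      also have "\<dots> \<in> zspan B" using mem ij(3) by (intro zspan_sum zspan_of_int_mult) auto
      finally show ?thesis .
    qed
  qed
  have b: "b * x \<in> zspan B" if x: "x \<in> B" for x
  proof -
    obtain i j where ij: "x = a ^ i * b ^ j" "i < n" "j < m" using x by (auto simp: B_def)
    show ?thesis
    proof (cases "Suc j < m")
      case True
      then show ?thesis using mem[OF ij(2) True] by (simp add: ij(1) mult.left_commute)
    next
      case False
      then have "m = Suc j" using ij by simp
      then have "b * x = a ^ i * b ^ m" by (simp add: ij(1) mult.left_commute)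
      also have "\<dots> = (\<Sum>k<m. of_int (c' k) * (a ^ i * b ^ k))"
        by (simp add: m(2) sum_distrib_left mult.left_commute)
      also have "\<dots> \<in> zspan B" using mem ij(2) by (intro zspan_sum zspan_of_int_mult) auto
      finally show ?thesis .
    qed
  qed
  show "algebraic_int (a + b)"
    by (rule algebraic_int_if_zspan_stable[OF fin one]) (simp_all add: distrib_right zspan_add a b)
  show "algebraic_int (a * b)"
  proof (rule algebraic_int_if_zspan_stable[OF fin one])
    fix x assume "x \<in> B"
    then show "a * b * x \<in> zspan B"
      using zspan_mult_closed[of B a, OF a b] by (simp add: mult.assoc)
  qed simp
qed

lemma algebraic_int_sum:
  fixes w :: "'b \<Rightarrow> 'a::field_char_0"
  shows "(\<And>i. i \<in> I \<Longrightarrow> algebraic_int (w i)) \<Longrightarrow> algebraic_int (\<Sum>i\<in>I. w i)"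
  by (induction I rule: infinite_finite_induct) (auto intro: algebraic_int_add_times)

lemma algebraic_int_power:
  fixes x :: "'a::field_char_0"
  shows "algebraic_int x \<Longrightarrow> algebraic_int (x ^ k)"
  by (induction k) (auto intro: algebraic_int_add_times)

section \<open>The order generated by an algebraic integer\<close>

abbreviation (input) ieval :: "int poly \<Rightarrow> 'a::comm_ring_1 \<Rightarrow> 'a" where
  "ieval y \<equiv> poly (map_poly of_int y)"

abbreviation (input) reval :: "rat poly \<Rightarrow> complex \<Rightarrow> complex" where
  "reval y \<equiv> poly (map_poly of_rat y)"

interpretation of_rat_poly_hom: map_poly_idom_hom of_rat ..

lemma map_poly_of_rat_of_int:
  "map_poly of_rat (map_poly of_int y) = (map_poly of_int y :: 'a::field_char_0 poly)"
  by (simp add: map_poly_map_poly o_def)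

lemma irreducible_not_dvd_bezout:
  fixes q y :: "'a::field_gcd poly"
  assumes "irreducible q" "\<not> q dvd y"
  obtains u v where "u * q + v * y = 1"
proof -
  have "coprime q y"
    by (rule coprimeI) (use assms irreducibleD' dvd_trans in blast)
  then have "gcd q y = 1" by simp
  then show ?thesis using that bezout_coefficients_fst_snd[of q y] by metis
qed

lemma min_poly_dvd_rat:
  assumes "is_min_poly d f" "reval y d = 0"
  shows "map_poly of_int f dvd y"
proof (rule ccontr)
  assume "\<not> map_poly of_int f dvd y"
  then obtain u v where uv: "u * map_poly of_int f + v * y = 1"
    using irreducible_not_dvd_bezout assms(1) unfolding is_min_poly_def by metis
  have "reval (u * map_poly of_int f + v * y) d = 0"
    using assms by (simp add: is_min_poly_def of_rat_poly_hom.hom_add of_rat_poly_hom.hom_mult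
        map_poly_of_rat_of_int)
  then show False by (simp add: uv)
qed

lemma monic_division:
  fixes f y :: "'a::comm_ring_1 poly"
  assumes "lead_coeff f = 1"
  obtains q r where "y = f * q + r" "r = 0 \<or> degree r < degree f"
proof -
  obtain q r where qr: "pseudo_divmod y f = (q, r)" by fastforce
  have "f \<noteq> 0" using assms by auto
  show ?thesis
    using that[of q r] pseudo_divmod[OF \<open>f \<noteq> 0\<close> qr] assms by simp
qed

text \<open>Division by the monic f stays within integer polynomials, so the rational divisibility
  is only needed to kill the remainder by its degree. This replaces an appeal to Gauss's
  lemma.\<close>

lemma min_poly_dvd_int:
  assumes f: "is_min_poly d f" and "ieval y d = 0"
  shows "f dvd y"
proof -
  have lc: "lead_coeff f = 1" and fd: "ieval f d = 0" using f by (auto simp: is_min_poly_def)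
  obtain q r where qr: "y = f * q + r" "r = 0 \<or> degree r < degree f"
    using monic_division[OF lc] by metis
  have "ieval r d = 0"
    using assms(2) fd by (simp add: qr(1) of_int_poly_hom.hom_add of_int_poly_hom.hom_mult)
  then have "reval (map_poly of_int r) d = 0" by (simp add: map_poly_of_rat_of_int)
  then have "(map_poly of_int f :: rat poly) dvd map_poly of_int r"
    by (rule min_poly_dvd_rat[OF f])
  then have "r \<noteq> 0 \<Longrightarrow> degree f \<le> degree r"
    using dvd_imp_degree_le[of "map_poly of_int f :: rat poly" "map_poly of_int r"] by simp
  then have "r = 0" using qr(2) by linarith
  then show ?thesis using qr(1) by simp
qed

text \<open>Q(d) = Q[d]: a Bezout identity between f and the denominator b provides a polynomial
  value inverse to b(d).\<close>

lemma num_field_eq_reval: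
  assumes "is_min_poly d f"
  shows "num_field d = range (\<lambda>a. reval a d)"
proof (intro equalityI subsetI)
  fix x assume "x \<in> num_field d"
  then obtain a b where ab: "reval b d \<noteq> 0" "x = reval a d / reval b d"
    unfolding num_field_def by blast
  have fd: "ieval f d = 0" and irr: "irreducible (map_poly of_int f :: rat poly)"
    using assms by (auto simp: is_min_poly_def)
  have "\<not> map_poly of_int f dvd b"
  proof
    assume "map_poly of_int f dvd b"
    then obtain k where "b = map_poly of_int f * k" ..
    then show False using ab(1) fd by (simp add: of_rat_poly_hom.hom_mult map_poly_of_rat_of_int)
  qed
  then obtain u v where uv: "u * map_poly of_int f + v * b = 1"
    using irreducible_not_dvd_bezout[OF irr] by metis
  have "reval (u * map_poly of_int f + v * b) d = reval v d * reval b d"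
    using fd by (simp add: of_rat_poly_hom.hom_add of_rat_poly_hom.hom_mult map_poly_of_rat_of_int)
  then have "reval v d * reval b d = 1" by (simp add: uv)
  moreover have "x * reval b d = reval a d" using ab by simp
  ultimately have "x = reval a d * reval v d" by (metis mult.assoc mult.commute mult_1_right)
  then have "x = reval (a * v) d" by (simp add: of_rat_poly_hom.hom_mult)
  then show "x \<in> range (\<lambda>a. reval a d)" by blast
next
  fix x assume "x \<in> range (\<lambda>a. reval a d)"
  then obtain a where "x = reval a d" by blast
  then have "reval 1 d \<noteq> 0 \<and> x = reval a d / reval 1 d" by simp
  then show "x \<in> num_field d" unfolding num_field_def by blast
qed

definition int_adjoin :: "complex \<Rightarrow> complex set" where
  "int_adjoin d = range (\<lambda>y. ieval y d)"

lemma ieval_in_int_adjoin: "ieval y d \<in> int_adjoin d"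
  by (simp add: int_adjoin_def)

lemma ieval_add: "ieval (y + z) x = ieval y x + ieval z x"
  and ieval_diff: "ieval (y - z) x = ieval y x - ieval z x"
  and ieval_mult: "ieval (y * z) x = ieval y x * ieval z x"
  by (simp_all add: of_int_poly_hom.hom_add of_int_poly_hom.hom_minus of_int_poly_hom.hom_mult)

lemma int_adjoin_mult: "x \<in> int_adjoin d \<Longrightarrow> y \<in> int_adjoin d \<Longrightarrow> x * y \<in> int_adjoin d"
  unfolding int_adjoin_def by (auto simp flip: ieval_mult)

lemma add_subgroup_int_adjoin: "add_subgroup (int_adjoin d)"
  unfolding add_subgroup_def int_adjoin_def
proof (intro conjI ballI)
  show "0 \<in> range (\<lambda>y. ieval y d)" by (rule range_eqI[of _ _ 0]) simp
qed (auto simp flip: ieval_diff)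

lemma algebraic_int_ieval:
  fixes x :: "'a::field_char_0"
  assumes "algebraic_int x"
  shows "algebraic_int (ieval y x)"
  unfolding poly_altdef
  by (intro algebraic_int_sum algebraic_int_add_times algebraic_int_power assms) simp

lemma int_adjoin_subset_ring_of_integers:
  assumes "is_min_poly d f" "algebraic_int d"
  shows "int_adjoin d \<subseteq> ring_of_integers (num_field d)"
  unfolding int_adjoin_def ring_of_integers_def num_field_eq_reval[OF assms(1)]
  using algebraic_int_ieval[OF assms(2)] map_poly_of_rat_of_int[where 'a = complex] by (auto simp: image_iff) metis

lemma num_field_closed:
  assumes "is_min_poly d f" "x \<in> num_field d" "y \<in> num_field d"
  shows "x + y \<in> num_field d" "x - y \<in> num_field d" "x * y \<in> num_field d"
  using assms(2,3) unfolding num_field_eq_reval[OF assms(1)]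
  by (auto simp flip: poly_add poly_diff poly_mult of_rat_poly_hom.hom_add of_rat_poly_hom.hom_minus
      of_rat_poly_hom.hom_mult)

lemma ring_of_integers_closed:
  assumes "is_min_poly d f"
    and "x \<in> ring_of_integers (num_field d)" "y \<in> ring_of_integers (num_field d)"
  shows "x + y \<in> ring_of_integers (num_field d)" "x - y \<in> ring_of_integers (num_field d)"
    "x * y \<in> ring_of_integers (num_field d)"
  using assms(2,3) num_field_closed[OF assms(1)] algebraic_int_add_times
    algebraic_int_add_times(1)[of x "- y"]
  by (auto simp: ring_of_integers_def)

lemma ring_of_integers_of_int:
  assumes "is_min_poly d f"
  shows "of_int k \<in> ring_of_integers (num_field d)"
proof -
  have "of_int k = reval [:of_int k:] d" by (simp add: of_rat_hom.map_poly_pCons_hom)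
  then have "of_int k \<in> num_field d" unfolding num_field_eq_reval[OF assms] by blast
  then show ?thesis by (simp add: ring_of_integers_def)
qed

lemma add_subgroup_ring_of_integers:
  assumes "is_min_poly d f"
  shows "add_subgroup (ring_of_integers (num_field d))"
  unfolding add_subgroup_def
  using ring_of_integers_closed[OF assms] ring_of_integers_of_int[OF assms, of 0] by auto

section \<open>The order has finite index in the ring of integers\<close>

lemma clear_denominators:
  fixes v :: "rat poly"
  obtains m :: int and V where "m \<noteq> 0" "smult (of_int m) v = map_poly of_int V"
proof -
  have "\<exists>m V. m \<noteq> 0 \<and> smult (of_int m) v = map_poly of_int V"
  proof (induction v)
    case 0
    show ?case by (rule exI[of _ 1], rule exI[of _ 0]) simp
  next
    case (pCons c v)
    then obtain m V where mV: "m \<noteq> 0" "smult (of_int m) v = map_poly of_int V" by blast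
    obtain a b where ab: "c = of_int a / of_int b" "b \<noteq> 0"
      by (cases c) (auto simp: Fract_of_int_quotient)
    have "smult (of_int (m * b)) (pCons c v) = map_poly of_int (pCons (m * a) (smult b V))"
      using mV ab(2) by (simp add: ab(1) of_int_hom.map_poly_pCons_hom of_int_hom.map_poly_hom_smult
          mult.commute flip: smult_smult)
    then show ?case using mV(1) ab(2) by (metis mult_eq_0_iff)
  qed
  then show ?thesis using that by blast
qed

lemma algebraic_int_coeff_mult:
  fixes p q :: "'a::field_char_0 poly"
  assumes "\<And>i. algebraic_int (coeff p i)" "\<And>i. algebraic_int (coeff q i)"
  shows "algebraic_int (coeff (p * q) i)"
  unfolding coeff_mult by (intro algebraic_int_sum algebraic_int_add_times assms)

lemma algebraic_int_coeff_prod_linear: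
  fixes Z :: "'a::field_char_0 set"
  assumes "\<And>z. z \<in> Z \<Longrightarrow> algebraic_int z"
  shows "algebraic_int (coeff (\<Prod>z\<in>Z. [:- z, 1:]) i)"
  using assms
proof (induction Z arbitrary: i rule: infinite_finite_induct)
  case (insert z Z)
  have "algebraic_int (coeff [:- z, 1:] k)" for k
    using insert.prems[of z] by (auto simp: coeff_pCons split: nat.split)
  then show ?case using insert by (simp add: algebraic_int_coeff_mult del: mult_pCons_left)
qed (auto simp: coeff_1)

text \<open>f is irreducible and its derivative is nonzero of smaller degree, so both are coprime.
  The identity serves twice: it makes the complex roots of f simple, and at d it exhibits the
  inverse of f'(d).\<close>

lemma min_poly_deriv_bezout:
  assumes "is_min_poly d f"
  obtains u v :: "rat poly" where "u * map_poly of_int f + v * map_poly of_int (pderiv f) = 1"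
proof -
  let ?F = "map_poly of_int f :: rat poly"
  have irr: "irreducible ?F" using assms by (auto simp: is_min_poly_def)
  have "degree ?F \<noteq> 0"
  proof
    assume "degree ?F = 0"
    then have "is_unit ?F" using irr by (metis irreducible_def is_unit_iff_degree)
    then show False using irr by (simp add: irreducible_def)
  qed
  then have ne: "pderiv ?F \<noteq> 0" by (simp add: pderiv_eq_0_iff)
  have "\<not> ?F dvd pderiv ?F"
  proof
    assume "?F dvd pderiv ?F"
    then have "degree ?F \<le> degree (pderiv ?F)" using ne by (rule dvd_imp_degree_le)
    then show False using \<open>degree ?F \<noteq> 0\<close> by (simp add: degree_pderiv)
  qed
  then show ?thesis
    using irreducible_not_dvd_bezout[OF irr] that by (metis of_int_hom.map_poly_pderiv)
qed

text \<open>Euler's description of the dual lattice: with x = a(d), the Lagrange interpolation polynomial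
  of the values a(z) f'(z) at the roots z of f has algebraic integer coefficients, because it is
  the sum of the a(z) f(X)/(X - z), and rational ones, because it is the remainder of a f'
  modulo f.\<close>
lemma deriv_mult_ring_of_integers:
  assumes f: "is_min_poly d f" and x: "x \<in> ring_of_integers (num_field d)"
  shows "ieval (pderiv f) d * x \<in> int_adjoin d"
proof -
  let ?F = "map_poly of_int f :: rat poly" and ?fc = "map_poly of_int f :: complex poly"
  have lc: "lead_coeff f = 1" and fd: "ieval f d = 0" using f by (auto simp: is_min_poly_def)
  have Fc: "map_poly of_rat ?F = ?fc" by (rule map_poly_of_rat_of_int)
  obtain a where a: "x = reval a d"
    using x unfolding ring_of_integers_def num_field_eq_reval[OF f] by blast
  obtain u v where uv: "u * ?F + v * map_poly of_int (pderiv f) = 1"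
    using min_poly_deriv_bezout[OF f] by blast
  have "rsquarefree ?fc"
    unfolding rsquarefree_roots
  proof (intro allI notI)
    fix z assume z: "poly ?fc z = 0 \<and> poly (pderiv ?fc) z = 0"
    then have "reval (u * ?F + v * map_poly of_int (pderiv f)) z = 0"
      by (simp add: of_rat_poly_hom.hom_add of_rat_poly_hom.hom_mult map_poly_of_rat_of_int
          of_int_hom.map_poly_pderiv of_rat_hom.map_poly_pderiv)
    then show False by (simp add: uv)
  qed
  define Z where "Z = {z. poly ?fc z = 0}"
  have fc_prod: "?fc = (\<Prod>z\<in>Z. [:- z, 1:])"
    using complex_poly_decompose_rsquarefree[OF \<open>rsquarefree ?fc\<close>] lc by (simp add: Z_def)
  have "?fc \<noteq> 0" using lc by auto
  then have fin: "finite Z" unfolding Z_def by (rule poly_roots_finite)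
  have "degree ?fc = card Z" unfolding fc_prod by (simp add: degree_prod_eq_sum_degree)
  then have card: "degree f = card Z" by simp
  have Zalg: "algebraic_int z" if "z \<in> Z" for z
    using that lc unfolding Z_def algebraic_int_altdef_ipoly by blast
  have "algebraic_int x" using x by (simp add: ring_of_integers_def)
  then obtain r where r: "ieval r x = 0" "lead_coeff r = 1"
    unfolding algebraic_int_altdef_ipoly by blast
  have comp: "reval (pcompose (map_poly of_int r) a) z = ieval r (reval a z)" for z
    by (simp add: of_rat_hom.map_poly_pcompose map_poly_of_rat_of_int poly_pcompose)
  \<comment> \<open>All conjugates of x are integral: r(a(X)) vanishes at d, hence is a multiple of
    the minimal polynomial, hence vanishes at every root z of f, so that a(z) is a root of the monic
    r.\<close>
  have "?F dvd pcompose (map_poly of_int r) a"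
    by (rule min_poly_dvd_rat[OF f]) (simp add: comp r(1) flip: a)
  then obtain k where k: "pcompose (map_poly of_int r) a = ?F * k" ..
  have aalg: "algebraic_int (reval a z)" if "z \<in> Z" for z
  proof -
    have "ieval r (reval a z) = 0"
      using that by (simp add: Z_def k of_rat_poly_hom.hom_mult Fc flip: comp)
    then show ?thesis using r(2) unfolding algebraic_int_altdef_ipoly by blast
  qed
  define H where "H z = (\<Prod>w\<in>Z - {z}. [:- w, 1:])" for z
  define G where "G = (\<Sum>z\<in>Z. smult (reval a z) (H z))"
  have "algebraic_int (coeff (smult (reval a z) (H z)) i)" if z: "z \<in> Z" for z i
    unfolding coeff_smult H_def
    by (intro algebraic_int_add_times(2) aalg z algebraic_int_coeff_prod_linear Zalg) auto
  then have Galg: "algebraic_int (coeff G i)" for i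
    unfolding G_def coeff_sum by (intro algebraic_int_sum) blast
  have H0: "poly (H w) z = 0" if "z \<in> Z" "w \<noteq> z" for z w
    using that fin by (auto simp: H_def poly_prod prod_zero_iff)
  have dH: "poly (pderiv ?fc) z = poly (H z) z" if z: "z \<in> Z" for z
  proof -
    have "?fc = [:- z, 1:] * H z"
      unfolding fc_prod H_def using fin z by (rule prod.remove)
    then have "pderiv ?fc = [:- z, 1:] * pderiv (H z) + H z * pderiv [:- z, 1:]"
      by (simp only: pderiv_mult)
    then show ?thesis by (simp add: pderiv_pCons)
  qed
  define T where "T = (a * pderiv ?F) mod ?F"
  have Tz: "reval T z = reval a z * poly (pderiv ?fc) z" if "z \<in> Z" for z
  proof -
    have "a * pderiv ?F = ?F * ((a * pderiv ?F) div ?F) + T" by (simp add: T_def)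
    then have "reval (a * pderiv ?F) z = reval (?F * ((a * pderiv ?F) div ?F) + T) z" by simp
    then show ?thesis
      using that by (simp add: of_rat_poly_hom.hom_add of_rat_poly_hom.hom_mult Z_def
          of_rat_hom.map_poly_pderiv Fc)
  qed
  have dZ: "d \<in> Z" by (simp add: Z_def fd)
  then have "card Z > 0" using fin by (auto simp: card_gt_0_iff)
  \<comment> \<open>Both sides have degree below the number of roots of f, so agreement at the roots
    suffices. At a root z only the summand of z survives in G, and its factor \<open>H z\<close>
    takes the value f'(z) there.\<close>
  have "G = map_poly of_rat T"
  proof (rule poly_eqI_degree[of Z])
    fix z assume z: "z \<in> Z"
    have "poly G z = (\<Sum>w\<in>Z. reval a w * poly (H w) z)" by (simp add: G_def poly_sum)
    also have "\<dots> = (\<Sum>w\<in>Z. if w = z then reval a z * poly (H z) z else 0)"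
      using H0[OF z] by (intro sum.cong) auto
    also have "\<dots> = reval a z * poly (H z) z" using fin z by simp
    finally show "poly G z = reval T z" by (simp add: Tz[OF z] dH[OF z])
  next
    have "degree (H z) = card Z - 1" if "z \<in> Z" for z
      using that fin by (simp add: H_def degree_prod_eq_sum_degree)
    then have "degree G \<le> card Z - 1"
      unfolding G_def by (intro degree_sum_le fin) (metis degree_smult_le)
    then show "degree G < card Z" using \<open>card Z > 0\<close> by linarith
    have "degree T < degree ?F \<or> T = 0"
      unfolding T_def using lc degree_mod_less[of ?F] by (cases "f = 0") auto
    then show "degree (map_poly of_rat T) < card Z" using \<open>card Z > 0\<close> by (auto simp: card)
  qed
  have Tint: "coeff T i \<in> \<int>" for i
  proof -
    have "algebraic_int (of_rat (coeff T i) :: complex)"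
      using Galg[of i] by (simp add: \<open>G = map_poly of_rat T\<close>)
    then have "(of_rat (coeff T i) :: complex) \<in> \<int>"
      by (intro rational_algebraic_int_is_int) auto
    then obtain k where "(of_rat (coeff T i) :: complex) = of_int k" by (elim Ints_cases)
    then have "(of_rat (coeff T i) :: complex) = of_rat (of_int k)" by simp
    then have "coeff T i = of_int k" unfolding of_rat_eq_iff .
    then show ?thesis by simp
  qed
  define t where "t = map_poly floor T"
  have "T = map_poly of_int t"
    by (rule poly_eqI) (use Tint in \<open>simp add: t_def coeff_map_poly of_int_floor_cancel\<close>)
  then have "reval T d = ieval t d" by (simp add: map_poly_of_rat_of_int)
  then have "ieval (pderiv f) d * x = ieval t d"
    using Tz[OF dZ] by (simp add: a of_int_hom.map_poly_pderiv mult.commute)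
  then show ?thesis by (simp add: ieval_in_int_adjoin)
qed

text \<open>Multiplication by f'(d) already carries R into A. The Bezout identity gives v(d) f'(d) =
  1, and with m a common denominator of the coefficients of v this becomes V(d) f'(d) = m, an
  integer multiple of 1 with V(d) in A.\<close>

lemma ring_of_integers_bounded_denominator:
  assumes f: "is_min_poly d f"
  obtains m :: int where "m \<noteq> 0" "(*) (of_int m) ` ring_of_integers (num_field d) \<subseteq> int_adjoin d"
proof -
  obtain u v :: "rat poly" where uv: "u * map_poly of_int f + v * map_poly of_int (pderiv f) = 1"
    using min_poly_deriv_bezout[OF f] by blast
  obtain m V where mV: "m \<noteq> 0" "smult (of_int m) v = map_poly of_int V"
    using clear_denominators by blast
  have "reval (smult (of_int m) (u * map_poly of_int f + v * map_poly of_int (pderiv f))) d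
      = of_int m * reval v d * ieval (pderiv f) d"
    using f by (simp add: is_min_poly_def of_rat_poly_hom.hom_add of_rat_poly_hom.hom_mult
        map_poly_of_rat_of_int of_rat_hom.map_poly_hom_smult)
  also have "of_int m * reval v d = reval (smult (of_int m) v) d"
    by (simp add: of_rat_hom.map_poly_hom_smult)
  also have "\<dots> = ieval V d" by (simp add: mV(2) map_poly_of_rat_of_int)
  finally have m: "of_int m = ieval V d * ieval (pderiv f) d"
    by (simp add: uv of_rat_hom.map_poly_pCons_hom)
  have "of_int m * x \<in> int_adjoin d" if "x \<in> ring_of_integers (num_field d)" for x
    using int_adjoin_mult[OF ieval_in_int_adjoin[of V] deriv_mult_ring_of_integers[OF f that]]
    by (simp add: m mult.assoc)
  then show ?thesis using that[of m] mV(1) by blast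
qed

text \<open>The condition on the coefficients from N on, rather than on the degree, covers N = 0,
  where only the zero polynomial remains. This case occurs for remainders modulo a unit.\<close>

lemma card_poly_bounded_coeffs:
  fixes C :: "'a::zero set"
  assumes "finite C" "0 \<in> C"
  shows "finite {r. (\<forall>i\<ge>N. coeff r i = 0) \<and> (\<forall>i. coeff r i \<in> C)}"
    and "card {r. (\<forall>i\<ge>N. coeff r i = 0) \<and> (\<forall>i. coeff r i \<in> C)} = card C ^ N"
proof -
  let ?L = "{xs. set xs \<subseteq> C \<and> length xs = N}"
  let ?X = "{r. (\<forall>i\<ge>N. coeff r i = 0) \<and> (\<forall>i. coeff r i \<in> C)}"
  have "bij_betw Poly ?L ?X"
  proof (rule bij_betwI[where g = "\<lambda>r. map (coeff r) [0..<N]"])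
    show "Poly \<in> ?L \<rightarrow> ?X"
    proof
      fix xs assume "xs \<in> ?L"
      then have "set xs \<subseteq> C" "length xs = N" by auto
      then have "\<forall>i\<ge>N. coeff (Poly xs) i = 0" "\<forall>i. coeff (Poly xs) i \<in> C"
        using assms(2) nth_mem[of _ xs] by (auto simp: coeff_Poly_eq nth_default_def)
      then show "Poly xs \<in> ?X" by blast
    qed
    show "(\<lambda>r. map (coeff r) [0..<N]) \<in> ?X \<rightarrow> ?L" by auto
    show "map (coeff (Poly xs)) [0..<N] = xs" if "xs \<in> ?L" for xs
      using that by (auto intro!: nth_equalityI simp: coeff_Poly_eq nth_default_def)
    show "Poly (map (coeff r) [0..<N]) = r" if "r \<in> ?X" for r
      using that by (intro poly_eqI) (auto simp: coeff_Poly_eq nth_default_def)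
  qed
  then show "finite ?X" "card ?X = card C ^ N"
    using finite_lists_length_eq[OF assms(1), of N] card_lists_length_eq[OF assms(1), of N]
      bij_betw_finite[of Poly ?L ?X] bij_betw_same_card[of Poly ?L ?X] by simp_all
qed

text \<open>Division by the monic f and then reduction of the coefficients modulo m leave finitely
  many representatives.\<close>

lemma finite_cosets_int_adjoin_mult:
  assumes f: "is_min_poly d f" and "m \<noteq> 0"
  shows "finite (cosets (int_adjoin d) ((*) (of_int m) ` int_adjoin d))"
proof -
  have lc: "lead_coeff f = 1" and fd: "ieval f d = 0" using f by (auto simp: is_min_poly_def)
  define X where "X = {r. (\<forall>i\<ge>degree f. coeff r i = 0) \<and> (\<forall>i. coeff r i \<in> (\<lambda>c. c mod m) ` UNIV)}"
  have "c mod m \<in> {- \<bar>m\<bar>..\<bar>m\<bar>}" for c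
    using abs_mod_less[OF \<open>m \<noteq> 0\<close>, of c] unfolding atLeastAtMost_iff by linarith
  then have "range (\<lambda>c. c mod m) \<subseteq> {- \<bar>m\<bar>..\<bar>m\<bar>}" by (rule image_subsetI)
  then have "finite (range (\<lambda>c. c mod m))" by (rule finite_subset) simp
  then have "finite X" unfolding X_def
    by (rule card_poly_bounded_coeffs) (rule range_eqI[of _ _ 0], simp)
  have "cosets (int_adjoin d) ((*) (of_int m) ` int_adjoin d) =
      (\<lambda>r. {z. z - ieval r d \<in> (*) (of_int m) ` int_adjoin d}) ` X"
  proof (rule cosets_parametrize)
    show "add_subgroup ((*) (of_int m) ` int_adjoin d)"
      by (intro add_subgroup_mult_image add_subgroup_int_adjoin)
    show "(\<lambda>r. ieval r d) ` X \<subseteq> int_adjoin d" using ieval_in_int_adjoin by blast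
  next
    fix z assume "z \<in> int_adjoin d"
    then obtain y where y: "z = ieval y d" unfolding int_adjoin_def by blast
    obtain q r where qr: "y = f * q + r" "r = 0 \<or> degree r < degree f"
      using monic_division[OF lc] by metis
    define r1 where "r1 = map_poly (\<lambda>c. c div m) r"
    define r2 where "r2 = map_poly (\<lambda>c. c mod m) r"
    have r: "r = smult m r1 + r2"
      by (rule poly_eqI) (simp add: r1_def r2_def coeff_map_poly)
    have "coeff r i = 0" if "i \<ge> degree f" for i
      using qr(2) that by (auto intro: coeff_eq_0)
    then have "r2 \<in> X" by (auto simp: X_def r2_def coeff_map_poly)
    moreover have "z - ieval r2 d = of_int m * ieval r1 d"
      by (simp add: y qr(1) ieval_add ieval_mult fd r of_int_hom.map_poly_hom_smult)
    ultimately show "\<exists>r\<in>X. z - ieval r d \<in> (*) (of_int m) ` int_adjoin d"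
      using ieval_in_int_adjoin by blast
  qed
  then show ?thesis using \<open>finite X\<close> by simp
qed

text \<open>A common denominator m puts mR between mA and A. The index of A in R equals that of mA
  in mR, which is a factor of the nonzero index of mA in A.\<close>

lemma finite_cosets_ring_of_integers:
  assumes f: "is_min_poly d f" and d: "algebraic_int d"
  shows "finite (cosets (ring_of_integers (num_field d)) (int_adjoin d))"
proof -
  let ?A = "int_adjoin d" and ?R = "ring_of_integers (num_field d)"
  obtain m :: int where m: "m \<noteq> 0" "(*) (of_int m) ` ?R \<subseteq> ?A"
    using ring_of_integers_bounded_denominator[OF f] by blast
  let ?m = "(*) (of_int m :: complex)"
  note A = add_subgroup_int_adjoin[of d] and R = add_subgroup_ring_of_integers[OF f]
  have "sub_index ?A (?m ` ?A) = sub_index ?A (?m ` ?R) * sub_index (?m ` ?R) (?m ` ?A)"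
    by (intro sub_index_tower add_subgroup_mult_image A R image_mono m
        int_adjoin_subset_ring_of_integers[OF f d])
  moreover have "sub_index ?A (?m ` ?A) \<noteq> 0"
    using finite_cosets_int_adjoin_mult[OF f m(1)] sub_index_nonzero_iff add_subgroup_zero[OF A]
    by blast
  moreover have "sub_index (?m ` ?R) (?m ` ?A) = sub_index ?R ?A"
    by (rule sub_index_mult_image[OF A]) (simp add: m(1))
  ultimately have "sub_index ?R ?A \<noteq> 0" by simp
  then show ?thesis using sub_index_nonzero_iff add_subgroup_zero[OF R] by blast
qed

section \<open>Reduction modulo a prime\<close>

abbreviation (input) red :: "int poly \<Rightarrow> 'p::prime_card mod_ring poly" where
  "red \<equiv> map_poly of_int"

lemma red_add: "red (y + z) = red y + red z"
  and red_diff: "red (y - z) = red y - red z"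
  and red_mult: "red (y * z) = red y * red z"
  by (simp_all add: of_int_poly_hom.hom_add of_int_poly_hom.hom_minus of_int_poly_hom.hom_mult)

lemma surj_red: "surj (red :: int poly \<Rightarrow> 'p::prime_card mod_ring poly)"
proof (rule surjI[where g = red and f = "map_poly to_int_mod_ring"])
  fix y :: "'p mod_ring poly"
  show "red (map_poly to_int_mod_ring y) = y"
    by (rule poly_eqI) (simp add: coeff_map_poly of_int_of_int_mod_ring)
qed

lemma red_eq_0_iff:
  "(red y :: 'p::prime_card mod_ring poly) = 0 \<longleftrightarrow> (\<exists>z. y = smult (int CARD('p)) z)"
proof
  assume y: "(red y :: 'p mod_ring poly) = 0"
  have "int CARD('p) dvd coeff y i" for i
  proof -
    have "coeff (red y :: 'p mod_ring poly) i = 0" by (simp add: y)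
    then have "(of_int (coeff y i) :: 'p mod_ring) = 0" by (simp add: coeff_map_poly)
    then show ?thesis by (simp add: of_int_eq_0_iff_char_dvd)
  qed
  then have "y = smult (int CARD('p)) (map_poly (\<lambda>c. c div int CARD('p)) y)"
    by (intro poly_eqI) (simp add: coeff_map_poly)
  then show "\<exists>z. y = smult (int CARD('p)) z" by blast
next
  assume "\<exists>z. y = smult (int CARD('p)) z"
  then obtain z where "y = smult (int CARD('p)) z" ..
  then show "(red y :: 'p mod_ring poly) = 0"
    by (simp add: of_int_hom.map_poly_hom_smult)
qed

lemma monic_red:
  assumes "lead_coeff f = 1"
  shows "lead_coeff (red f :: 'p::prime_card mod_ring poly) = 1"
    and "degree (red f :: 'p mod_ring poly) = degree f"
proof -
  have "degree (red f :: 'p mod_ring poly) = degree f"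
    using assms by (intro degree_map_poly) auto
  then show "degree (red f :: 'p mod_ring poly) = degree f"
    "lead_coeff (red f :: 'p mod_ring poly) = 1" using assms by (simp_all add: coeff_map_poly)
qed

lemma card_red_mod:
  fixes Q :: "'p::prime_card mod_ring poly"
  assumes "Q \<noteq> 0"
  shows "card (range (\<lambda>y. red y mod Q)) = CARD('p) ^ degree Q"
proof -
  have "range (\<lambda>y. red y mod Q) = {r. \<forall>i\<ge>degree Q. coeff r i = 0}"
  proof (intro equalityI subsetI)
    fix r assume "r \<in> range (\<lambda>y. red y mod Q)"
    then obtain y where r: "r = red y mod Q" by blast
    have "r = 0 \<or> degree r < degree Q"
      using degree_mod_less[OF assms, of "red y"] by (simp add: r)
    then show "r \<in> {r. \<forall>i\<ge>degree Q. coeff r i = 0}" by (auto intro: coeff_eq_0)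
  next
    fix r :: "'p mod_ring poly" assume r: "r \<in> {r. \<forall>i\<ge>degree Q. coeff r i = 0}"
    obtain y where y: "r = red y" using surj_red by blast
    have "r = 0 \<or> degree r < degree Q"
      using r by (metis (mono_tags) leading_coeff_0_iff mem_Collect_eq not_le)
    then have "r mod Q = r" by (auto simp: mod_poly_less)
    then show "r \<in> range (\<lambda>y. red y mod Q)" using y by (metis rangeI)
  qed
  then show ?thesis
    using card_poly_bounded_coeffs(2)[of "UNIV :: 'p mod_ring set" "degree Q"] by simp
qed

definition prime_complement :: "complex \<Rightarrow> 'p::prime_card mod_ring poly \<Rightarrow> complex set" where
  "prime_complement d q = {ieval u d | u. \<not> q dvd red u}"

lemma prime_complement_subset: "prime_complement d q \<subseteq> int_adjoin d"
  by (auto simp: prime_complement_def ieval_in_int_adjoin)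

lemma submonoid_prime_complement:
  assumes "irreducible q"
  shows "submonoid_mult (prime_complement d q)"
  unfolding submonoid_mult_def
proof (intro conjI ballI)
  have "\<not> q dvd red 1"
    using irreducible_not_unit[OF assms] unfolding of_int_poly_hom.hom_one .
  moreover have "ieval 1 d = 1" by simp
  ultimately show "1 \<in> prime_complement d q"
    unfolding prime_complement_def by (metis (mono_tags, lifting) mem_Collect_eq)
next
  fix s t assume "s \<in> prime_complement d q" "t \<in> prime_complement d q"
  then obtain u v where uv: "s = ieval u d" "\<not> q dvd red u" "t = ieval v d" "\<not> q dvd red v"
    by (auto simp: prime_complement_def)
  have "prime_elem q" using assms by (rule field_poly_irreducible_imp_prime)
  then have "\<not> q dvd red (u * v)" using uv by (simp add: red_mult prime_elem_dvd_mult_iff)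
  moreover have "s * t = ieval (u * v) d" by (simp add: uv ieval_mult)
  ultimately show "s * t \<in> prime_complement d q" unfolding prime_complement_def by blast
qed

section \<open>The localized order at a prime above p\<close>

context
  fixes d :: complex and f :: "int poly" and q :: "'p::prime_card mod_ring poly"
  assumes f: "is_min_poly d f" and q: "irreducible q"
begin

private abbreviation (input) "S \<equiv> prime_complement d q"
private abbreviation (input) "m \<equiv> multiplicity q (red f)"

lemma min_poly_red: "lead_coeff f = 1" "ieval f d = 0" "red f \<noteq> (0 :: 'p mod_ring poly)"
proof -
  show *: "lead_coeff f = 1" and "ieval f d = 0" using f by (auto simp: is_min_poly_def)
  show "red f \<noteq> (0 :: 'p mod_ring poly)" using monic_red(1)[OF *, where 'p = 'p]
    by (metis leading_coeff_0_iff zero_neq_one)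
qed

text \<open>This is the isomorphism of A/pA with k[x]/(f mod p), both being Z[x]/(p, f).\<close>

lemma ieval_in_mult_int_adjoin_iff:
  "ieval y d \<in> (*) (of_nat CARD('p)) ` int_adjoin d \<longleftrightarrow> red f dvd (red y :: 'p mod_ring poly)"
proof
  assume "ieval y d \<in> (*) (of_nat CARD('p)) ` int_adjoin d"
  then obtain z where "ieval y d = of_nat CARD('p) * ieval z d" by (auto simp: int_adjoin_def)
  then have "ieval (y - smult (int CARD('p)) z) d = 0"
    by (simp add: ieval_diff of_int_hom.map_poly_hom_smult)
  then have "f dvd y - smult (int CARD('p)) z" by (rule min_poly_dvd_int[OF f])
  then obtain k where "y - smult (int CARD('p)) z = f * k" ..
  then have "y = f * k + smult (int CARD('p)) z" by (simp add: algebra_simps)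
  then have "(red y :: 'p mod_ring poly) = red f * red k"
    by (simp add: red_add red_mult of_int_hom.map_poly_hom_smult)
  then show "red f dvd (red y :: 'p mod_ring poly)" by simp
next
  assume "red f dvd (red y :: 'p mod_ring poly)"
  then obtain k' :: "'p mod_ring poly" where "red y = red f * k'" ..
  moreover obtain k where "k' = red k" using surj_red by blast
  ultimately have "(red (y - f * k) :: 'p mod_ring poly) = 0" by (simp add: red_diff red_mult)
  then obtain z where "y - f * k = smult (int CARD('p)) z" unfolding red_eq_0_iff by blast
  then have "y = f * k + smult (int CARD('p)) z" by (simp add: algebra_simps)
  then have "ieval y d = of_nat CARD('p) * ieval z d"
    using min_poly_red(2) by (simp add: ieval_add ieval_mult of_int_hom.map_poly_hom_smult)
  then show "ieval y d \<in> (*) (of_nat CARD('p)) ` int_adjoin d" using ieval_in_int_adjoin by blast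
qed

text \<open>Polynomials prime to q become invertible, so only the q-primary part of f modulo p
  survives. In one direction a denominator is cancelled because it is coprime to q^m; in the other
  the cofactor of q^m in f modulo p is itself a denominator.\<close>

lemma ieval_in_loc_iff: "ieval y d \<in> loc S ((*) (of_nat CARD('p)) ` int_adjoin d) \<longleftrightarrow> q ^ m dvd red y"
proof
  assume "ieval y d \<in> loc S ((*) (of_nat CARD('p)) ` int_adjoin d)"
  then obtain u where u: "\<not> q dvd red u" "ieval u d * ieval y d \<in> (*) (of_nat CARD('p)) ` int_adjoin d"
    by (auto simp: loc_def prime_complement_def)
  have "q ^ m dvd red f" by (rule multiplicity_dvd)
  also have "red f dvd (red (u * y) :: 'p mod_ring poly)"
    using u(2) ieval_in_mult_int_adjoin_iff[of "u * y"] by (simp add: ieval_mult)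
  also have "red (u * y) = (red u * red y :: 'p mod_ring poly)" by (rule red_mult)
  finally have *: "q ^ m dvd red u * red y" .
  have "coprime q (red u)" by (rule coprimeI) (use q u(1) irreducibleD' dvd_trans in blast)
  then have "coprime (q ^ m) (red u)" by simp
  then show "q ^ m dvd red y" using * by (simp add: coprime_dvd_mult_right_iff)
next
  assume y: "q ^ m dvd red y"
  obtain w where w: "red f = q ^ m * w" "\<not> q dvd w"
    by (rule multiplicity_decompose'[OF min_poly_red(3) irreducible_not_unit[OF q]])
  obtain u where u: "w = red u" using surj_red by blast
  have "q ^ m * w dvd red y * red u" using y by (intro mult_dvd_mono) (simp_all add: u)
  then have "red f dvd (red (u * y) :: 'p mod_ring poly)"
    unfolding w(1)[symmetric] by (simp only: red_mult mult.commute)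
  then have "ieval u d * ieval y d \<in> (*) (of_nat CARD('p)) ` int_adjoin d"
    using ieval_in_mult_int_adjoin_iff[of "u * y"] by (simp add: ieval_mult)
  moreover have "ieval u d \<in> S" using w(2) u by (auto simp: prime_complement_def)
  ultimately show "ieval y d \<in> loc S ((*) (of_nat CARD('p)) ` int_adjoin d)" by (auto simp: loc_def)
qed

lemma stable_mult_int_adjoin: "stable_under S ((*) (of_nat CARD('p)) ` int_adjoin d)"
  unfolding stable_under_def
proof (intro ballI)
  fix s x assume s: "s \<in> S" and "x \<in> (*) (of_nat CARD('p)) ` int_adjoin d"
  then obtain y where "x = of_nat CARD('p) * y" "y \<in> int_adjoin d" by blast
  then have "s * x = of_nat CARD('p) * (s * y)" "s * y \<in> int_adjoin d"
    using int_adjoin_mult subsetD[OF prime_complement_subset s] by (auto simp: mult.left_commute)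
  then show "s * x \<in> (*) (of_nat CARD('p)) ` int_adjoin d" by blast
qed

lemma sub_index_loc_int_adjoin:
  "sub_index (loc S (int_adjoin d)) (loc S ((*) (of_nat CARD('p)) ` int_adjoin d)) = CARD('p) ^ (degree q * m)"
proof -
  note S = submonoid_prime_complement[OF q, of d]
  have N: "add_subgroup (loc S ((*) (of_nat CARD('p)) ` int_adjoin d))"
    by (intro add_subgroup_loc S stable_mult_int_adjoin add_subgroup_mult_image
        add_subgroup_int_adjoin)
  have "sub_index (loc S (int_adjoin d)) (loc S ((*) (of_nat CARD('p)) ` int_adjoin d)) = card (range (\<lambda>y. red y mod q ^ m))"
  proof (rule sub_index_eq_card[OF N, where \<phi> = "\<lambda>y. ieval y d"])
    show "range (\<lambda>y. ieval y d) \<subseteq> loc S (int_adjoin d)"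
      using subset_loc[OF S, of "int_adjoin d"] ieval_in_int_adjoin by blast
  next
    fix z assume "z \<in> loc S (int_adjoin d)"
    then obtain u y where u: "\<not> q dvd red u" "ieval u d * z = ieval y d"
      by (auto simp: loc_def prime_complement_def int_adjoin_def)
    have "coprime q (red u)" by (rule coprimeI) (use q u(1) irreducibleD' dvd_trans in blast)
    then have "gcd (q ^ m) (red u) = 1" by simp
    \<comment> \<open>Modulo q^m the denominator u has an inverse c, so the fraction z = y/u is
      represented by a lift b of c y.\<close>
    then obtain a c where ac: "a * q ^ m + c * red u = 1"
      using bezout_coefficients_fst_snd[of "q ^ m" "red u"] by metis
    obtain b where b: "red b = c * red y" using surj_red by (metis surjD)
    have "red (y - u * b) = (1 - c * red u) * red y"
      by (simp add: red_diff red_mult b algebra_simps)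
    also have "1 - c * red u = a * q ^ m" by (simp flip: ac)
    finally have "q ^ m dvd red (y - u * b)" by simp
    then have "ieval (y - u * b) d \<in> loc S ((*) (of_nat CARD('p)) ` int_adjoin d)" using ieval_in_loc_iff by blast
    then have "ieval u d * (z - ieval b d) \<in> loc S ((*) (of_nat CARD('p)) ` int_adjoin d)"
      by (simp add: ieval_diff ieval_mult right_diff_distrib u(2))
    moreover have "ieval u d \<in> S" using u(1) by (auto simp: prime_complement_def)
    ultimately have "z - ieval b d \<in> loc S ((*) (of_nat CARD('p)) ` int_adjoin d)" using loc_cancel[OF S] by blast
    then show "\<exists>x\<in>UNIV. z - ieval x d \<in> loc S ((*) (of_nat CARD('p)) ` int_adjoin d)" by blast
  next
    fix x y
    have "ieval x d - ieval y d \<in> loc S ((*) (of_nat CARD('p)) ` int_adjoin d) \<longleftrightarrow> q ^ m dvd red x - red y"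
      using ieval_in_loc_iff[of "x - y"] by (simp add: ieval_diff red_diff)
    then show "ieval x d - ieval y d \<in> loc S ((*) (of_nat CARD('p)) ` int_adjoin d) \<longleftrightarrow> red x mod q ^ m = red y mod q ^ m"
      by (simp add: mod_eq_dvd_iff)
  qed
  also have "\<dots> = CARD('p) ^ degree (q ^ m)"
    using q by (intro card_red_mod) auto
  also have "degree (q ^ m) = degree q * m"
    using q by (subst degree_power_eq) (auto simp: mult.commute)
  finally show ?thesis .
qed

end

section \<open>Ideals of the ring of integers\<close>

lemma OK_ring_simps:
  "carrier (OK_ring K) = ring_of_integers K" "x \<otimes>\<^bsub>OK_ring K\<^esub> y = x * y" "x \<oplus>\<^bsub>OK_ring K\<^esub> y = x + y"
  "\<one>\<^bsub>OK_ring K\<^esub> = 1" "\<zero>\<^bsub>OK_ring K\<^esub> = 0"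
  by (simp_all add: OK_ring_def)

lemma cring_OK_ring:
  assumes f: "is_min_poly d f"
  shows "cring (OK_ring (num_field d))"
proof (intro cringI abelian_groupI comm_monoidI)
  note closed = ring_of_integers_closed[OF f]
  note of_int = ring_of_integers_of_int[OF f]
  fix x assume x: "x \<in> carrier (OK_ring (num_field d))"
  show "\<exists>y\<in>carrier (OK_ring (num_field d)). y \<oplus>\<^bsub>OK_ring (num_field d)\<^esub> x = \<zero>\<^bsub>OK_ring (num_field d)\<^esub>"
    using closed(2)[of 0 x] of_int[of 0] x by (intro bexI[of _ "- x"]) (auto simp: OK_ring_simps)
qed (use ring_of_integers_closed[OF f] ring_of_integers_of_int[OF f, of 0]
    ring_of_integers_of_int[OF f, of 1] in \<open>auto simp: OK_ring_simps algebra_simps\<close>)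

context
  fixes d :: complex and f :: "int poly"
  assumes f: "is_min_poly d f"
begin

private abbreviation (input) "OK \<equiv> OK_ring (num_field d)"
private abbreviation (input) "RI \<equiv> ring_of_integers (num_field d)"

interpretation OK: cring OK by (rule cring_OK_ring[OF f])

lemma one_in_ring_of_integers: "1 \<in> RI" and of_nat_in_ring_of_integers: "of_nat k \<in> RI"
  using ring_of_integers_of_int[OF f, of 1] ring_of_integers_of_int[OF f, of "int k"] by simp_all

lemma ideal_OK:
  assumes "ideal I OK"
  shows ideal_OK_subset: "I \<subseteq> RI" and ideal_OK_mult: "r \<in> RI \<Longrightarrow> x \<in> I \<Longrightarrow> r * x \<in> I"
    and ideal_OK_subgroup: "add_subgroup I"
proof -
  interpret ideal I OK by fact
  show "I \<subseteq> RI" using a_subset by (simp add: OK_ring_simps)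
  show mult: "r * x \<in> I" if "r \<in> RI" "x \<in> I" for r x
    using I_l_closed[of x r] that by (simp add: OK_ring_simps)
  have "x - y \<in> I" if "x \<in> I" "y \<in> I" for x y
    using a_closed[of x "of_int (- 1) * y"] mult[OF ring_of_integers_of_int[OF f, of "-1"], of y] that
    by (simp add: OK_ring_simps)
  then show "add_subgroup I" using zero_closed by (simp add: add_subgroup_def OK_ring_simps)
qed

lemma ideal_prod_OK_mult: "x \<in> I \<Longrightarrow> y \<in> J \<Longrightarrow> x * y \<in> ideal_prod OK I J"
  using ideal_prod.prod[of x I y J OK] by (simp add: OK_ring_simps)

lemma ideal_prod_OK_induct [consumes 1, case_names mult add]:
  assumes "x \<in> ideal_prod OK I J" "\<And>x y. x \<in> I \<Longrightarrow> y \<in> J \<Longrightarrow> Q (x * y)"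
    "\<And>x y. Q x \<Longrightarrow> Q y \<Longrightarrow> Q (x + y)"
  shows "Q x"
  using assms(1) by (induction rule: ideal_prod.induct) (auto simp: OK_ring_simps assms(2,3))

text \<open>Translates the residue degree, which is given through \<open>Quot\<close>, into an
  index.\<close>

lemma card_Quot_OK:
  "card (carrier (OK Quot I)) = sub_index RI I"
proof -
  have "I #>\<^bsub>add_monoid OK\<^esub> x = {y. y - x \<in> I}" for x
  proof -
    have "I #>\<^bsub>add_monoid OK\<^esub> x = {h + x | h. h \<in> I}" by (auto simp: r_coset_def OK_ring_simps)
    also have "\<dots> = {y. y - x \<in> I}"
      by (auto intro: exI[of _ "_ - x"])
    finally show ?thesis .
  qed
  then have "carrier (OK Quot I) = cosets RI I"
    by (auto simp: FactRing_def A_RCOSETS_def RCOSETS_def cosets_def OK_ring_simps)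
  then show ?thesis by (simp add: sub_index_def)
qed

lemma PIdl_OK: "PIdl\<^bsub>OK\<^esub> c = (*) c ` RI"
  by (auto simp: cgenideal_def OK_ring_simps mult.commute)

lemma primeideal_OK:
  assumes "primeideal P OK"
  shows "ideal P OK" "1 \<notin> P" "x \<in> RI \<Longrightarrow> y \<in> RI \<Longrightarrow> x * y \<in> P \<Longrightarrow> x \<in> P \<or> y \<in> P"
proof -
  interpret primeideal P OK by fact
  show ideal: "ideal P OK" by (rule is_ideal)
  show "x \<in> RI \<Longrightarrow> y \<in> RI \<Longrightarrow> x * y \<in> P \<Longrightarrow> x \<in> P \<or> y \<in> P"
    using I_prime by (simp add: OK_ring_simps)
  show "1 \<notin> P" using one_imp_carrier I_notcarr by (auto simp: OK_ring_simps)
qed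

text \<open>A finite domain is a field: two powers u^i and u^j agree modulo P, and cancelling u^i
  shows that u^(j-i-1) is an inverse of u modulo P.\<close>

lemma finite_primeideal_division:
  assumes P: "primeideal P OK" and fin: "finite (cosets RI P)"
    and u: "u \<in> RI" "u \<notin> P" and v: "v \<in> RI"
  obtains r where "r \<in> RI" "v - r * u \<in> P"
proof -
  note prime = primeideal_OK[OF P]
  note idl = ideal_OK[OF prime(1)] and closed = ring_of_integers_closed[OF f]
  have pow: "u ^ k \<in> RI" "u ^ k \<notin> P" for k
  proof (induction k)
    case (Suc k)
    { case 1 show ?case using Suc closed(3) u by simp }
    { case 2 show ?case using Suc prime(3)[of u "u ^ k"] u by auto }
  qed (use one_in_ring_of_integers prime(2) in auto)
  define F where "F k = {x. x - u ^ k \<in> P}" for k :: nat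
  have "range F \<subseteq> cosets RI P" unfolding F_def cosets_def using pow by blast
  then have "finite (range F)" using fin finite_subset by blast
  then have "\<not> inj F" using finite_imageD by fastforce
  then obtain i j where ij: "F i = F j" "i < j" unfolding inj_def by (metis nat_neq_iff)
  then have "u ^ i - u ^ j \<in> P" by (simp add: F_def coset_eq_iff[OF idl(3)])
  moreover have "u ^ j = u ^ i * u ^ (j - i)"
    unfolding power_add[symmetric] using ij(2) by simp
  ultimately have "u ^ i * (1 - u ^ (j - i)) \<in> P" by (simp add: right_diff_distrib)
  then have "1 - u ^ (j - i) \<in> P"
    using prime(3) pow closed(2)[OF one_in_ring_of_integers] by blast
  then have "v * (1 - u ^ (j - i)) \<in> P" using idl(2)[OF v] by blast
  moreover have "u ^ (j - i) = u ^ (j - Suc i) * u"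
    using ij(2) by (metis Suc_diff_Suc power_Suc2)
  ultimately have "v - (v * u ^ (j - Suc i)) * u \<in> P"
    by (simp add: right_diff_distrib mult.assoc)
  then show ?thesis using that[of "v * u ^ (j - Suc i)"] closed(3) v pow by blast
qed

section \<open>Localized indices along a factorization into ideals\<close>

lemma stable_under_ideal: "ideal I OK \<Longrightarrow> S \<subseteq> RI \<Longrightarrow> stable_under S I"
  using ideal_OK_mult by (auto simp: stable_under_def)

text \<open>An ideal I that divides a nonzero principal ideal (c) is invertible, so I/IP is a
  one-dimensional vector space over the residue field of P; here C is c times the inverse of I.\<close>
lemma sub_index_loc_primeideal:
  assumes P: "primeideal P OK" and fin: "finite (cosets RI P)"
    and I: "ideal I OK" and C: "ideal C OK" and c: "c \<noteq> 0" "ideal_prod OK I C = (*) c ` RI"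
    and S: "submonoid_mult S" "S \<subseteq> RI"
  shows "sub_index (loc S I) (loc S (ideal_prod OK I P)) = (if S \<inter> P = {} then sub_index RI P else 1)"
proof -
  note prime = primeideal_OK[OF P]
  note idlP = ideal_OK[OF prime(1)] and idlI = ideal_OK[OF I] and closed = ring_of_integers_closed[OF f]
  let ?IP = "ideal_prod OK I P"
  have IP: "ideal ?IP OK" by (rule OK.ideal_prod_is_ideal[OF I prime(1)])
  note idlIP = ideal_OK[OF IP]
  have sub: "add_subgroup (loc S I)" "add_subgroup (loc S ?IP)"
    using add_subgroup_loc[OF S(1)] stable_under_ideal[OF _ S(2)] I IP idlI(3) idlIP(3) by blast+
  have "?IP \<subseteq> I" using OK.ideal_prod_inter[OF I prime(1)] by blast
  show ?thesis
  proof (cases "S \<inter> P = {}")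
    case False
    then obtain t where t: "t \<in> S" "t \<in> P" by blast
    have "loc S I \<subseteq> loc S ?IP"
    proof
      fix x assume "x \<in> loc S I"
      then obtain s where s: "s \<in> S" "s * x \<in> I" by (auto simp: loc_def)
      have "(s * t) * x \<in> ?IP"
        using ideal_prod_OK_mult[OF s(2) t(2)] by (simp add: mult_ac)
      moreover have "s * t \<in> S" using S(1) s t by (simp add: submonoid_mult_def)
      ultimately show "x \<in> loc S ?IP" by (auto simp: loc_def)
    qed
    then have "loc S ?IP = loc S I" using loc_mono[OF \<open>?IP \<subseteq> I\<close>] by blast
    then show ?thesis using False sub_index_self[OF sub(1)] by simp
  next
    case True
    have quot: "\<exists>r\<in>RI. x * y = c * r" if "x \<in> I" "y \<in> C" for x y
      using ideal_prod_OK_mult[OF that] c(2) by auto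
    have cP: "add_subgroup ((*) c ` P)" and cIP: "add_subgroup ((*) c ` ?IP)"
      by (intro add_subgroup_mult_image idlP idlIP)+
    \<comment> \<open>Together with \<open>IP_I\<close>: an element x of I lies in IP exactly if xC
      is contained in cP. Each y in C thus gives a test map x -> xy/c from I to R, and IP is where
      all tests take values in P.\<close>
    have IP_D: "x * y \<in> (*) c ` P" if "x \<in> ?IP" and y: "y \<in> C" for x y
      using that(1)
    proof (induction rule: ideal_prod_OK_induct)
      case (mult i j)
      obtain r where "r \<in> RI" "i * y = c * r" using quot[OF mult(1) y] by blast
      then have "r * j \<in> P" "i * j * y = c * (r * j)"
        using idlP(2)[of r j] mult(2) by (simp_all add: mult_ac)
      then show ?case by blast
    next
      case (add x z)
      then show ?case using add_subgroup_add[OF cP] by (simp add: distrib_right)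
    qed
    have c_mem: "c \<in> ideal_prod OK I C" using c(2) one_in_ring_of_integers by force
    have IP_I: "x \<in> ?IP" if x: "x \<in> I" "\<And>y. y \<in> C \<Longrightarrow> x * y \<in> (*) c ` P" for x
    proof -
      have "x * w \<in> (*) c ` ?IP" if "w \<in> ideal_prod OK I C" for w
        using that
      proof (induction rule: ideal_prod_OK_induct)
        case (mult i y)
        obtain z where z: "z \<in> P" "x * y = c * z" using x(2)[OF mult(2)] by blast
        have "x * (i * y) = i * (x * y)" by (rule mult.left_commute)
        also have "\<dots> = c * (i * z)" by (simp add: z(2))
        finally show ?case using ideal_prod_OK_mult[OF mult(1) z(1)] by blast
      next
        case (add w z)
        then show ?case using add_subgroup_add[OF cIP] by (simp add: distrib_left)
      qed
      from this[OF c_mem] show ?thesis using c(1) by (auto simp: mult.commute)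
    qed
    \<comment> \<open>Otherwise c, as an element of IC, would lie in cP, and 1 would lie in
      P.\<close>
    have "\<not> I \<subseteq> ?IP"
    proof
      assume "I \<subseteq> ?IP"
      have "w \<in> (*) c ` P" if "w \<in> ideal_prod OK I C" for w
        using that
      proof (induction rule: ideal_prod_OK_induct)
        case (mult i y)
        then show ?case using IP_D \<open>I \<subseteq> ?IP\<close> by blast
      qed (rule add_subgroup_add[OF cP])
      from this[OF c_mem] show False using c(1) prime(2) by auto
    qed
    \<comment> \<open>The element a will generate I modulo IP over the residue field. The test y0
      detects it: the value u of that test at a is invertible modulo P.\<close>
    then obtain a where a: "a \<in> I" "a \<notin> ?IP" by blast
    then obtain y0 where y0: "y0 \<in> C" "a * y0 \<notin> (*) c ` P" using IP_I by blast
    obtain u where u: "u \<in> RI" "a * y0 = c * u" using quot[OF a(1) y0(1)] by blast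
    have uP: "u \<notin> P" using y0(2) u(2) by blast
    have torsion_free: "x \<in> ?IP" if x: "x \<in> I" and s: "s \<in> RI" "s \<notin> P" "s * x \<in> ?IP" for x s
    proof (rule IP_I[OF x])
      fix y assume y: "y \<in> C"
      obtain r where r: "r \<in> RI" "x * y = c * r" using quot[OF x y] by blast
      have "s * x * y \<in> (*) c ` P" using IP_D[OF s(3) y] .
      then have "c * (s * r) \<in> (*) c ` P" using r(2) by (simp add: mult_ac)
      then have "s * r \<in> P" using c(1) by auto
      then have "r \<in> P" using prime(3) s r by blast
      then show "x * y \<in> (*) c ` P" using r(2) by blast
    qed
    have ker: "r * a \<in> ?IP \<longleftrightarrow> r \<in> P" if r: "r \<in> RI" for r
    proof
      assume "r \<in> P"
      then show "r * a \<in> ?IP" using ideal_prod_OK_mult[OF a(1)] by (metis mult.commute)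
    next
      assume "r * a \<in> ?IP"
      then show "r \<in> P" using torsion_free[OF a(1) r] a(2) by blast
    qed
    have gen: "\<exists>r\<in>RI. b - r * a \<in> ?IP" if b: "b \<in> I" for b
    proof -
      obtain v where v: "v \<in> RI" "b * y0 = c * v" using quot[OF b y0(1)] by blast
      obtain r where r: "r \<in> RI" "v - r * u \<in> P"
        using finite_primeideal_division[OF P fin u(1) uP v(1)] by blast
      have bra: "b - r * a \<in> I" using add_subgroup_diff[OF idlI(3) b] idlI(2)[OF r(1) a(1)] by blast
      have "b - r * a \<in> ?IP"
      proof (rule IP_I[OF bra])
        fix y assume y: "y \<in> C"
        obtain x where x: "x \<in> RI" "(b - r * a) * y = c * x" using quot[OF bra y] by blast
        obtain z where z: "z \<in> RI" "a * y = c * z" using quot[OF a(1) y] by blast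
        \<comment> \<open>The single test y0 decides all others: exchanging y and y0 in ((b - r a)
          y)(a y0) makes the factor (b - r a) y0 = c (v - r u) appear, and r was chosen so that v -
          r u lies in P.\<close>
        have "c * x * (c * u) = (b - r * a) * y * (a * y0)" by (simp add: x(2) u(2))
        also have "\<dots> = (b * y0 - r * (a * y0)) * (a * y)" by (simp add: algebra_simps)
        also have "\<dots> = c * (v - r * u) * (c * z)" by (simp add: v(2) u(2) z(2) algebra_simps)
        finally have "x * u = z * (v - r * u)" using c(1) by (simp add: mult_ac)
        then have "x * u \<in> P" using idlP(2)[OF z(1) r(2)] by simp
        then have "x \<in> P" using prime(3) x(1) u(1) uP by blast
        then show "(b - r * a) * y \<in> (*) c ` P" using x(2) by blast
      qed
      then show ?thesis using r(1) by blast
    qed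
    have "sub_index (loc S I) (loc S ?IP) = sub_index RI P"
    proof (rule sub_index_eq_sub_index[OF sub(2) idlP(3), where \<phi> = "\<lambda>r. r * a"])
      show "(\<lambda>r. r * a) ` RI \<subseteq> loc S I" using idlI(2)[OF _ a(1)] subset_loc[OF S(1), of I] by blast
    next
      fix x assume "x \<in> loc S I"
      then obtain s where s: "s \<in> S" "s * x \<in> I" by (auto simp: loc_def)
      obtain r' where r': "r' \<in> RI" "s * x - r' * a \<in> ?IP" using gen[OF s(2)] by blast
      have "s \<in> RI" "s \<notin> P" using s S(2) True by auto
      \<comment> \<open>The denominator s is invertible modulo P, so r = r'/s in the residue field
        represents x where r' represents s x.\<close>
      then obtain r where r: "r \<in> RI" "r' - r * s \<in> P"
        using finite_primeideal_division[OF P fin _ _ r'(1)] by blast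
      have "(r' - r * s) * a \<in> ?IP"
        using ker[of "r' - r * s"] r idlP(1) by blast
      then have "(s * x - r' * a) + (r' - r * s) * a \<in> ?IP"
        using add_subgroup_add[OF idlIP(3) r'(2)] by blast
      then have "s * (x - r * a) \<in> ?IP" by (simp add: algebra_simps)
      then show "\<exists>r\<in>RI. x - r * a \<in> loc S ?IP" using s(1) r(1) by (auto simp: loc_def)
    next
      fix x y assume xy: "x \<in> RI" "y \<in> RI"
      have diff: "x - y \<in> RI" using closed(2) xy by blast
      have "x * a - y * a \<in> loc S ?IP \<longleftrightarrow> (\<exists>s\<in>S. (s * (x - y)) * a \<in> ?IP)"
        by (simp add: loc_def algebra_simps)
      also have "\<dots> \<longleftrightarrow> (\<exists>s\<in>S. s * (x - y) \<in> P)"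
        using ker closed(3) diff S(2) by (metis subsetD)
      also have "\<dots> \<longleftrightarrow> x - y \<in> P"
      proof
        assume "\<exists>s\<in>S. s * (x - y) \<in> P"
        then show "x - y \<in> P" using prime(3)[OF _ diff] S(2) True by blast
      next
        assume "x - y \<in> P"
        then show "\<exists>s\<in>S. s * (x - y) \<in> P"
          using S(1) by (intro bexI[of _ 1]) (auto simp: submonoid_mult_def)
      qed
      finally show "x * a - y * a \<in> loc S ?IP \<longleftrightarrow> x - y \<in> P" .
    qed
    then show ?thesis using True by simp
  qed
qed

text \<open>The cofactor C only serves to make I and J invertible.\<close>
definition loc_index_factor :: "complex \<Rightarrow> complex set \<Rightarrow> complex set \<Rightarrow> nat \<Rightarrow> bool" where
  "loc_index_factor c S J w \<longleftrightarrow> ideal J OK \<and>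
    (\<forall>I C. ideal I OK \<longrightarrow> ideal C OK \<longrightarrow>
      ideal_prod OK (ideal_prod OK I J) C =
        (*) c ` RI \<longrightarrow>
      sub_index (loc S I) (loc S (ideal_prod OK I J)) = w)"

lemma ideal_carrier_OK: "ideal RI OK"
  using OK.oneideal by (simp add: OK_ring_simps)

lemma ideal_prod_carrier_OK: "ideal I OK \<Longrightarrow> ideal_prod OK I RI = I" "ideal I OK \<Longrightarrow> ideal_prod OK RI I = I"
  using OK.ideal_prod_one[of I] OK.ideal_prod_commute[OF _ OK.oneideal, of I]
  by (simp_all add: OK_ring_simps)

lemma add_subgroup_loc_ideal:
  assumes "submonoid_mult S" "S \<subseteq> RI" "ideal I OK"
  shows "add_subgroup (loc S I)"
  using assms stable_under_ideal ideal_OK_subgroup by (intro add_subgroup_loc)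

lemma loc_index_factor_carrier:
  assumes "submonoid_mult S" "S \<subseteq> RI"
  shows "loc_index_factor c S RI 1"
  unfolding loc_index_factor_def
  using ideal_carrier_OK ideal_prod_carrier_OK(1) sub_index_self[OF add_subgroup_loc_ideal[OF assms]]
  by simp

text \<open>The tower law along I, IJ, IJJ'. The cofactor of the first step is J'C and that of the
  second is C, which explains why \<open>loc_index_factor\<close> quantifies over all I and
  C.\<close>

lemma loc_index_factor_prod:
  assumes S: "submonoid_mult S" "S \<subseteq> RI"
    and J: "loc_index_factor c S J w" and J': "loc_index_factor c S J' w'"
  shows "loc_index_factor c S (ideal_prod OK J J') (w * w')"
  unfolding loc_index_factor_def
proof (intro conjI allI impI)
  have idl: "ideal J OK" "ideal J' OK" using J J' by (auto simp: loc_index_factor_def)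
  then show "ideal (ideal_prod OK J J') OK" by (rule OK.ideal_prod_is_ideal)
  fix I C assume I: "ideal I OK" and C: "ideal C OK"
    and c: "ideal_prod OK (ideal_prod OK I (ideal_prod OK J J')) C = (*) c ` RI"
  have IJ: "ideal (ideal_prod OK I J) OK" and J'C: "ideal (ideal_prod OK J' C) OK"
    and IJJ': "ideal (ideal_prod OK (ideal_prod OK I J) J') OK"
    using I idl C by (simp_all add: OK.ideal_prod_is_ideal)
  have assoc: "ideal_prod OK I (ideal_prod OK J J') = ideal_prod OK (ideal_prod OK I J) J'"
    using OK.ideal_prod_assoc[OF I idl] by simp
  have "sub_index (loc S I) (loc S (ideal_prod OK I J)) = w"
    using J I J'C c OK.ideal_prod_assoc[OF IJ idl(2) C]
    unfolding loc_index_factor_def assoc by simp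
  moreover have "sub_index (loc S (ideal_prod OK I J)) (loc S (ideal_prod OK (ideal_prod OK I J) J')) = w'"
    using J' IJ C c unfolding loc_index_factor_def assoc by simp
  moreover have "loc S (ideal_prod OK (ideal_prod OK I J) J') \<subseteq> loc S (ideal_prod OK I J)"
    "loc S (ideal_prod OK I J) \<subseteq> loc S I"
    using OK.ideal_prod_inter[OF IJ idl(2)] OK.ideal_prod_inter[OF I idl(1)]
    by (intro loc_mono; blast)+
  ultimately show "sub_index (loc S I) (loc S (ideal_prod OK I (ideal_prod OK J J'))) = w * w'"
    unfolding assoc
    using sub_index_tower[OF add_subgroup_loc_ideal[OF S I] add_subgroup_loc_ideal[OF S IJ]
        add_subgroup_loc_ideal[OF S IJJ']] by simp
qed

lemma loc_index_factor_prime: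
  assumes P: "primeideal P OK" and fin: "finite (cosets RI P)"
    and c: "c \<noteq> 0" and S: "submonoid_mult S" "S \<subseteq> RI"
  shows "loc_index_factor c S P (if S \<inter> P = {} then sub_index RI P else 1)"
  unfolding loc_index_factor_def
proof (intro conjI allI impI)
  show idl: "ideal P OK" by (rule primeideal_OK[OF P])
  fix I C assume I: "ideal I OK" and C: "ideal C OK"
    and eq: "ideal_prod OK (ideal_prod OK I P) C = (*) c ` RI"
  then have "ideal_prod OK I (ideal_prod OK P C) = (*) c ` RI"
    using OK.ideal_prod_assoc[OF I idl C] by simp
  then show "sub_index (loc S I) (loc S (ideal_prod OK I P)) = (if S \<inter> P = {} then sub_index RI P else 1)"
    by (rule sub_index_loc_primeideal[OF P fin I OK.ideal_prod_is_ideal[OF idl C] c _ S])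
qed

lemma loc_index_factor_prod_list:
  assumes "submonoid_mult S" "S \<subseteq> RI" "\<And>i. i < g \<Longrightarrow> loc_index_factor c S (P i) (w i)"
  shows "loc_index_factor c S (ideal_prod_list OK P g) (\<Prod>i<g. w i)"
  using assms(3)
proof (induction g)
  case 0
  show ?case using loc_index_factor_carrier[OF assms(1,2)] by (simp add: OK_ring_simps)
qed (simp add: loc_index_factor_prod[OF assms(1,2)])

lemma loc_index_factor_pow:
  assumes "submonoid_mult S" "S \<subseteq> RI" "loc_index_factor c S J w"
  shows "loc_index_factor c S (ideal_pow OK J e) (w ^ e)"
proof (induction e)
  case 0
  show ?case using loc_index_factor_carrier[OF assms(1,2)] by (simp add: OK_ring_simps)
next
  case (Suc e)
  then show ?case using loc_index_factor_prod[OF assms(1,2) Suc assms(3)] by (simp add: mult.commute)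
qed

text \<open>For J = (c) the choice I = C = R meets the divisibility condition.\<close>

lemma sub_index_loc_principal:
  assumes "loc_index_factor c S ((*) c ` RI) w"
  shows "sub_index (loc S RI) (loc S ((*) c ` RI)) = w"
proof -
  have "ideal ((*) c ` RI) OK" using assms by (simp add: loc_index_factor_def)
  then show ?thesis
    using assms ideal_carrier_OK ideal_prod_carrier_OK unfolding loc_index_factor_def by metis
qed

section \<open>Residue fields and the class of d\<close>

lemma residue_polynomial:
  assumes P: "primeideal P OK" and p: "of_nat CARD('p) \<in> P" and d: "algebraic_int d"
  obtains q :: "'p::prime_card mod_ring poly"
  where "irreducible q" "lead_coeff q = 1" "\<And>y. ieval y d \<in> P \<longleftrightarrow> q dvd red y"
proof -
  note prime = primeideal_OK[OF P]
  note idl = ideal_OK[OF prime(1)]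
  have A: "ieval y d \<in> RI" for y
    using int_adjoin_subset_ring_of_integers[OF f d] ieval_in_int_adjoin by blast
  \<comment> \<open>\<open>N\<close> is the kernel of k[x] -> R/P sending x to the class of d; it is
    independent of the lift because p lies in P. The kernel is nonzero since it contains f modulo p,
    and prime since P is. Its monic generator q, found as an element of least degree, is therefore
    irreducible.\<close>
  define N where "N y' \<longleftrightarrow> (\<exists>y. y' = red y \<and> ieval y d \<in> P)" for y' :: "'p mod_ring poly"
  have N_red: "N (red y) \<longleftrightarrow> ieval y d \<in> P" for y
  proof
    assume "N (red y)"
    then obtain z where z: "(red y :: 'p mod_ring poly) = red z" "ieval z d \<in> P"
      unfolding N_def by blast
    then have "(red (y - z) :: 'p mod_ring poly) = 0" by (simp add: red_diff)
    then obtain k where "y - z = smult (int CARD('p)) k" unfolding red_eq_0_iff by blast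
    then have y: "y = z + smult (int CARD('p)) k" by (simp add: algebra_simps)
    have "ieval k d * of_nat CARD('p) \<in> P" using idl(2)[OF A p] .
    then show "ieval y d \<in> P"
      using add_subgroup_add[OF idl(3) z(2)]
      by (simp add: y ieval_add of_int_hom.map_poly_hom_smult mult.commute)
  qed (auto simp: N_def)
  have N_mult: "N (a * b)" if "N b" for a b
  proof -
    obtain y z where y: "a = red y" and z: "b = red z" using surj_red by (metis surjD)
    have "ieval y d * ieval z d \<in> P" using idl(2)[OF A] that N_red z by blast
    then show ?thesis using N_red[of "y * z"] by (simp add: y z red_mult ieval_mult)
  qed
  have N_diff: "N (a - b)" if "N a" "N b" for a b
  proof -
    obtain y z where y: "a = red y" and z: "b = red z" using surj_red by (metis surjD)
    have "ieval y d - ieval z d \<in> P" using add_subgroup_diff[OF idl(3)] that N_red y z by blast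
    then show ?thesis using N_red[of "y - z"] by (simp add: y z red_diff ieval_diff)
  qed
  have lc: "lead_coeff f = 1" and fd: "ieval f d = 0" using f by (auto simp: is_min_poly_def)
  have "N (red f)" unfolding N_red fd by (rule add_subgroup_zero[OF idl(3)])
  moreover have "red f \<noteq> (0 :: 'p mod_ring poly)"
    using monic_red(1)[OF lc, where 'p = 'p] by (metis leading_coeff_0_iff zero_neq_one)
  ultimately have "\<exists>x. (N x \<and> x \<noteq> 0) \<and> (\<forall>y. N y \<and> y \<noteq> 0 \<longrightarrow> degree x \<le> degree y)"
    by (intro ex_has_least_nat[of "\<lambda>y. N y \<and> y \<noteq> 0"] conjI)
  then obtain q0 where q0: "N q0" "q0 \<noteq> 0"
    and min: "\<And>y. N y \<Longrightarrow> y \<noteq> 0 \<Longrightarrow> degree q0 \<le> degree y"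
    by (elim exE conjE) simp
  define q where "q = smult (inverse (lead_coeff q0)) q0"
  have q: "q \<noteq> 0" "lead_coeff q = 1" "degree q = degree q0" using q0 by (auto simp: q_def)
  have "N q" using N_mult[OF q0(1), of "[:inverse (lead_coeff q0):]"] by (simp add: q_def)
  have q_iff: "N y \<longleftrightarrow> q dvd y" for y
  proof
    assume "N y"
    have "y mod q = y - (y div q) * q" by (simp add: minus_div_mult_eq_mod)
    then have "N (y mod q)" using N_diff[OF \<open>N y\<close> N_mult[OF \<open>N q\<close>]] by metis
    then have "y mod q = 0"
      using min[of "y mod q"] degree_mod_less[OF q(1), of y] q(3) by linarith
    then show "q dvd y" by (simp add: dvd_eq_mod_eq_0)
  next
    assume "q dvd y"
    then show "N y" using N_mult[OF \<open>N q\<close>] by (metis dvdE mult.commute)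
  qed
  have iff: "ieval y d \<in> P \<longleftrightarrow> q dvd red y" for y using N_red q_iff by blast
  have "prime_elem q"
  proof (rule prime_elemI)
    show "\<not> is_unit q" using iff[of 1] prime(2) by simp
    fix a b assume "q dvd a * b"
    obtain y z where y: "a = red y" and z: "b = red z" using surj_red by (metis surjD)
    have "ieval y d * ieval z d \<in> P"
      using \<open>q dvd a * b\<close> iff[of "y * z"] by (simp add: y z red_mult ieval_mult)
    then have "ieval y d \<in> P \<or> ieval z d \<in> P" using prime(3) A by blast
    then show "q dvd a \<or> q dvd b" using iff y z by blast
  qed (rule q(1))
  then show ?thesis using that[of q] prime_elem_imp_irreducible q(2) iff by blast
qed

text \<open>The subspaces of the residue field of P over the subfield generated by d, represented by
  their preimages W in the ring of integers, grow one dimension at a time.\<close>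
lemma residue_degree_dvd:
  fixes q :: "'p::prime_card mod_ring poly"
  assumes P: "primeideal P OK" and d: "algebraic_int d"
    and q: "irreducible q" "\<And>y. ieval y d \<in> P \<longleftrightarrow> q dvd red y"
    and h: "sub_index RI P = CARD('p) ^ h"
  shows "degree q dvd h"
proof -
  note prime = primeideal_OK[OF P]
  note idl = ideal_OK[OF prime(1)]
  note R = add_subgroup_ring_of_integers[OF f]
  have A: "ieval y d \<in> RI" for y
    using int_adjoin_subset_ring_of_integers[OF f d] ieval_in_int_adjoin by blast
  have p1: "CARD('p) > 1" using prime_card[where 'a = 'p] prime_gt_1_nat by blast
  have "degree q > 0" using irreducible_not_unit[OF q(1)] q(1) by (auto simp: is_unit_iff_degree)
  \<comment> \<open>The claim is wanted for W = P. The induction climbs from W towards R, and the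
    assumption that the index is nonzero, hence finite, makes it decrease strictly.\<close>
  have "\<exists>k. sub_index RI W = (CARD('p) ^ degree q) ^ k"
    if "add_subgroup W" "P \<subseteq> W" "W \<subseteq> RI" "\<And>y x. x \<in> W \<Longrightarrow> ieval y d * x \<in> W" "sub_index RI W \<noteq> 0"
    for W
    using that
  proof (induction "sub_index RI W" arbitrary: W rule: less_induct)
    case less
    note W = less.prems
    show ?case
    proof (cases "W = RI")
      case True
      then show ?thesis using sub_index_self[OF R] by (intro exI[of _ 0]) simp
    next
      case False
      then obtain x where x: "x \<in> RI" "x \<notin> W" using W(3) by blast
      \<comment> \<open>W' = W + Ax. Modulo W it is a line over k[x]/(q), so its index over W is
        p^(deg q).\<close>
      define W' where "W' = {w + ieval y d * x | w y. w \<in> W}"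
      have W'I: "w + ieval y d * x \<in> W'" if "w \<in> W" for w y using that by (auto simp: W'_def)
      have "W \<subseteq> W'" using W'I[of _ 0] by force
      have W': "add_subgroup W'"
        unfolding add_subgroup_def
      proof (intro conjI ballI)
        show "0 \<in> W'" using \<open>W \<subseteq> W'\<close> add_subgroup_zero[OF W(1)] by blast
        fix u v assume "u \<in> W'" "v \<in> W'"
        then obtain w y w' y' where uv: "w \<in> W" "u = w + ieval y d * x" "w' \<in> W" "v = w' + ieval y' d * x"
          by (auto simp: W'_def)
        have "u - v = (w - w') + ieval (y - y') d * x" by (simp add: uv ieval_diff algebra_simps)
        then show "u - v \<in> W'" using W'I add_subgroup_diff[OF W(1) uv(1,3)] by metis
      qed
      have W'_RI: "W' \<subseteq> RI"
        using W(3) A x(1) ring_of_integers_closed[OF f] by (auto simp: W'_def)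
      have W'_mult: "ieval y d * u \<in> W'" if u_mem: "u \<in> W'" for y u
      proof -
        obtain w y' where u: "w \<in> W" "u = w + ieval y' d * x" using u_mem by (auto simp: W'_def)
        have "ieval y d * u = ieval y d * w + ieval (y * y') d * x"
          by (simp add: u ieval_mult algebra_simps)
        then show ?thesis using W'I W(4)[OF u(1)] by metis
      qed
      have "sub_index W' W = card (range (\<lambda>y. red y mod q))"
      proof (rule sub_index_eq_card[OF W(1), where \<phi> = "\<lambda>y. ieval y d * x"])
        show "range (\<lambda>y. ieval y d * x) \<subseteq> W'" using W'I[OF add_subgroup_zero[OF W(1)]] by force
      next
        fix z assume "z \<in> W'"
        then obtain w y where "w \<in> W" "z = w + ieval y d * x" by (auto simp: W'_def)
        then show "\<exists>y\<in>UNIV. z - ieval y d * x \<in> W" by (intro bexI[of _ y]) simp_all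
      next
        fix y z
        have "ieval y d * x - ieval z d * x \<in> W \<longleftrightarrow> ieval (y - z) d * x \<in> W"
          by (simp add: ieval_diff left_diff_distrib)
        also have "\<dots> \<longleftrightarrow> q dvd red (y - z)"
        proof
          assume "q dvd red (y - z)"
          then have "ieval (y - z) d \<in> P" using q(2) by blast
          then have "x * ieval (y - z) d \<in> P" using idl(2)[OF x(1)] by blast
          then show "ieval (y - z) d * x \<in> W" using W(2) by (auto simp: mult.commute)
        next
          assume W_mem: "ieval (y - z) d * x \<in> W"
          show "q dvd red (y - z)"
          proof (rule ccontr)
            assume "\<not> q dvd red (y - z)"
            \<comment> \<open>If q does not divide y - z, then (y - z)(d) has an inverse v'(d)
              modulo P, and multiplying (y - z)(d) x by it would bring x itself into W.\<close>
            then obtain u v where uv: "u * q + v * red (y - z) = 1"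
              using irreducible_not_dvd_bezout[OF q(1)] by metis
            obtain v' where v': "v = red v'" using surj_red by blast
            have "red (1 - v' * (y - z)) = u * q"
              by (simp add: red_diff red_mult flip: uv v')
            then have "ieval (1 - v' * (y - z)) d \<in> P" using q(2) by simp
            then have "x * ieval (1 - v' * (y - z)) d \<in> W" using idl(2)[OF x(1)] W(2) by blast
            moreover have "ieval v' d * (ieval (y - z) d * x) \<in> W" using W(4)[OF W_mem] .
            ultimately have "x * ieval (1 - v' * (y - z)) d + ieval v' d * (ieval (y - z) d * x) \<in> W"
              by (rule add_subgroup_add[OF W(1)])
            moreover have "ieval (1 - v' * (y - z)) d = 1 - ieval v' d * ieval (y - z) d"
              by (simp only: ieval_diff[of 1] ieval_mult) simp
            ultimately have "x \<in> W" by (simp add: right_diff_distrib mult_ac)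
            then show False using x(2) by blast
          qed
        qed
        also have "\<dots> \<longleftrightarrow> red y mod q = red z mod q" by (simp add: red_diff mod_eq_dvd_iff)
        finally show "ieval y d * x - ieval z d * x \<in> W \<longleftrightarrow> red y mod q = red z mod q" .
      qed
      also have "\<dots> = CARD('p) ^ degree q" using q(1) by (intro card_red_mod) auto
      finally have W'W: "sub_index W' W = CARD('p) ^ degree q" .
      have tower: "sub_index RI W = sub_index RI W' * CARD('p) ^ degree q"
        using sub_index_tower[OF R W' W(1) \<open>W \<subseteq> W'\<close> W'_RI] W'W by simp
      then have nz: "sub_index RI W' \<noteq> 0" using W(5) by auto
      have "CARD('p) ^ degree q > 1" using p1 \<open>degree q > 0\<close> by (rule one_less_power)
      then have "sub_index RI W' < sub_index RI W" using tower nz by simp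
      moreover have "P \<subseteq> W'" using W(2) \<open>W \<subseteq> W'\<close> by blast
      ultimately obtain k where "sub_index RI W' = (CARD('p) ^ degree q) ^ k"
        using less.hyps W' W'_RI W'_mult nz by blast
      then show ?thesis using tower by (intro exI[of _ "Suc k"]) (simp add: mult.commute)
    qed
  qed
  from this[of P] obtain k where "sub_index RI P = (CARD('p) ^ degree q) ^ k"
    using idl A h p1 by auto
  then have "CARD('p) ^ h = CARD('p) ^ (degree q * k)" by (simp add: h power_mult)
  then show ?thesis using p1 by (simp add: power_inject_exp)
qed

end

section \<open>Comparison of multiplicities\<close>

text \<open>Localization commutes with multiplication by k and preserves finiteness of the index, so
  the comparison of commensurable groups applies to the localized pair.\<close>

lemma sub_index_loc_ring_of_integers:
  assumes f: "is_min_poly d f" and d: "algebraic_int d" and "k \<noteq> 0"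
    and S: "submonoid_mult S" "S \<subseteq> int_adjoin d"
  shows "sub_index (loc S (ring_of_integers (num_field d))) (loc S ((*) (of_nat k) ` ring_of_integers (num_field d)))
    = sub_index (loc S (int_adjoin d)) (loc S ((*) (of_nat k) ` int_adjoin d))"
proof -
  let ?R = "ring_of_integers (num_field d)" and ?A = "int_adjoin d" and ?k = "of_nat k :: complex"
  have k: "?k \<noteq> 0" using \<open>k \<noteq> 0\<close> by simp
  have AR: "?A \<subseteq> ?R" by (rule int_adjoin_subset_ring_of_integers[OF f d])
  have R: "add_subgroup ?R" "stable_under S ?R"
    using add_subgroup_ring_of_integers[OF f] ring_of_integers_closed(3)[OF f] S(2) AR
    by (auto simp: stable_under_def)
  have A: "add_subgroup ?A" "stable_under S ?A"
    using add_subgroup_int_adjoin int_adjoin_mult S(2) by (auto simp: stable_under_def)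
  have "(*) ?k ` ?R \<subseteq> ?R"
    using ring_of_integers_closed(3)[OF f] of_nat_in_ring_of_integers[OF f] by blast
  moreover have "(*) ?k ` ?A \<subseteq> ?A"
  proof -
    have "?k = ieval [:int k:] d" by (simp add: of_int_hom.map_poly_pCons_hom)
    then have "?k \<in> ?A" using ieval_in_int_adjoin by metis
    then show ?thesis using int_adjoin_mult by blast
  qed
  ultimately have "(*) ?k ` loc S ?R \<subseteq> loc S ?R" "(*) ?k ` loc S ?A \<subseteq> loc S ?A"
    unfolding loc_mult_image[OF k, symmetric] by (simp_all add: loc_mono)
  then show ?thesis
    unfolding loc_mult_image[OF k]
    by (intro sub_index_mult_image_commensurable add_subgroup_loc S R A loc_mono AR k
        finite_cosets_loc finite_cosets_ring_of_integers[OF f d])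
qed

lemma monic_irreducible_imp_prime:
  fixes q :: "'a::field_gcd poly"
  assumes "irreducible q" "lead_coeff q = 1"
  shows "prime q"
  using assms field_poly_irreducible_imp_prime normalize_monic
  by (auto simp: prime_def)

text \<open>Shows that p is not a unit of R, which excludes e = 0.\<close>

lemma inverse_of_nat_not_algebraic_int:
  assumes "k > 1"
  shows "\<not> algebraic_int (inverse (of_nat k) :: complex)"
proof
  assume "algebraic_int (inverse (of_nat k) :: complex)"
  then have "(inverse (of_nat k) :: complex) \<in> \<int>"
    by (rule rational_algebraic_int_is_int) (intro Rats_inverse Rats_of_nat)
  then obtain z where "(inverse (of_nat k) :: complex) = of_int z" by (elim Ints_cases)
  then have "of_int (z * int k) = (1 :: complex)" using assms by (simp add: field_simps)
  then have "z * int k = 1" by (simp only: of_int_eq_1_iff)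
  then have "int k dvd 1" by (metis dvd_triv_right)
  then show False using assms by simp
qed

text \<open>Used to see that every prime of the factorization contains p.\<close>

lemma ideal_pow_prod_list_subset:
  assumes f: "is_min_poly d f" and P: "\<And>i. i < g \<Longrightarrow> ideal (P i) (OK_ring (num_field d))"
    and "i < g" "e \<noteq> 0"
  shows "ideal_pow (OK_ring (num_field d)) (ideal_prod_list (OK_ring (num_field d)) P g) e \<subseteq> P i"
proof -
  interpret OK: cring "OK_ring (num_field d)" by (rule cring_OK_ring[OF f])
  let ?O = "OK_ring (num_field d)"
  have list: "ideal (ideal_prod_list ?O P k) ?O \<and> (\<forall>i<k. ideal_prod_list ?O P k \<subseteq> P i)" if "k \<le> g" for k
    using that
  proof (induction k)
    case (Suc k)
    then have "ideal (ideal_prod_list ?O P k) ?O" "ideal (P k) ?O" using P by auto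
    then show ?case
      using OK.ideal_prod_is_ideal OK.ideal_prod_inter[of "ideal_prod_list ?O P k" "P k"] Suc
      by (auto simp: less_Suc_eq) blast
  qed (simp add: OK.oneideal)
  let ?J = "ideal_prod_list ?O P g"
  have J: "ideal ?J ?O" "?J \<subseteq> P i" using list[of g] \<open>i < g\<close> by auto
  have pow: "ideal (ideal_pow ?O ?J k) ?O" for k
    by (induction k) (auto simp: OK.oneideal OK.ideal_prod_is_ideal J)
  obtain e' where "e = Suc e'" using \<open>e \<noteq> 0\<close> not0_implies_Suc by blast
  then show ?thesis using OK.ideal_prod_inter[OF pow[of e'] J(1)] J(2) by auto
qed

theorem mainTheorem1:
  fixes d :: complex and f :: "int poly" and n g e h :: nat
    and P :: "nat \<Rightarrow> complex set"
    and TYPE_p :: "'p :: prime_card itself"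
  assumes d_int: "algebraic_int d"
    and f_min: "is_min_poly d f"
    and n_def: "n = degree f"
    and gal: "galois_over_Q (num_field d)"
    and p_def: "p = CARD('p)"
    and P_prime: "\<forall>i<g. primeideal (P i) (OK_ring (num_field d))"
    and P_dist: "inj_on P {..<g}"
    and P_res: "\<forall>i<g. has_residue_degree (OK_ring (num_field d)) (P i) p h"
    and fact: "PIdl\<^bsub>OK_ring (num_field d)\<^esub> (of_nat p) =
       ideal_pow (OK_ring (num_field d)) (ideal_prod_list (OK_ring (num_field d)) P g) e"
  shows "\<exists>(fs :: nat \<Rightarrow> 'p mod_ring poly) (gs :: nat \<Rightarrow> 'p mod_ring poly) (es :: nat \<Rightarrow> nat).
           map_poly of_int f = (\<Prod>i<g. fs i) ^ e
         \<and> (\<forall>i<g. degree (fs i) = h \<and> irreducible (gs i) \<and> es i \<ge> 1 \<and> fs i = gs i ^ es i)"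
proof -
  let ?O = "OK_ring (num_field d)" and ?R = "ring_of_integers (num_field d)"
  have p1: "p > 1" using prime_card[where 'a = 'p] prime_gt_1_nat p_def by blast
  then have p0: "(of_nat p :: complex) \<noteq> 0" by simp
  have lc: "lead_coeff f = 1" using f_min by (simp add: is_min_poly_def)
  have prime: "primeideal (P i) ?O" if "i < g" for i using P_prime that by blast
  note ideal = primeideal_OK(1)[OF f_min prime]
  have res: "sub_index ?R (P i) = p ^ h" if "i < g" for i
    using P_res that by (simp add: has_residue_degree_def card_Quot_OK[OF f_min])
  have one: "1 \<in> ?R" by (rule one_in_ring_of_integers[OF f_min])
  have fin: "finite (cosets ?R (P i))" if "i < g" for i
    using res[OF that] p1 one sub_index_nonzero_iff[of ?R "P i"] by auto
  have PIdl: "(*) (of_nat p) ` ?R = ideal_pow ?O (ideal_prod_list ?O P g) e"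
    using fact by (simp add: PIdl_OK[OF f_min])
  have "e \<noteq> 0"
  proof
    assume "e = 0"
    then have "1 \<in> (*) (of_nat p) ` ?R" using PIdl one by (simp add: OK_ring_simps)
    then obtain r where r: "r \<in> ?R" "1 = of_nat p * r" by blast
    then have "r = inverse (of_nat p)" using p0 by (simp add: field_simps)
    then have "algebraic_int (inverse (of_nat p) :: complex)" using r(1) by (simp add: ring_of_integers_def)
    then show False using inverse_of_nat_not_algebraic_int[OF p1] by blast
  qed
  have p_mem: "of_nat CARD('p) \<in> P i" if "i < g" for i
  proof -
    have "of_nat p \<in> (*) (of_nat p) ` ?R" using one by force
    moreover have "ideal_pow ?O (ideal_prod_list ?O P g) e \<subseteq> P i"
      by (rule ideal_pow_prod_list_subset[OF f_min _ that \<open>e \<noteq> 0\<close>]) (rule ideal)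
    ultimately show ?thesis unfolding PIdl p_def[symmetric] by blast
  qed
  have "\<exists>q :: 'p mod_ring poly. irreducible q \<and> lead_coeff q = 1 \<and> (\<forall>y. ieval y d \<in> P i \<longleftrightarrow> q dvd red y)"
    if "i < g" for i
    using residue_polynomial[OF f_min prime[OF that] p_mem[OF that] d_int] by metis
  then obtain gs :: "nat \<Rightarrow> 'p mod_ring poly" where
    gs: "\<And>i. i < g \<Longrightarrow> irreducible (gs i)" "\<And>i. i < g \<Longrightarrow> lead_coeff (gs i) = 1"
      "\<And>i y. i < g \<Longrightarrow> ieval y d \<in> P i \<longleftrightarrow> gs i dvd red y" by metis
  have gs_prime: "prime (gs i)" if "i < g" for i
    using monic_irreducible_imp_prime gs that by blast
  have gs_dvd: "degree (gs i) dvd h" if "i < g" for i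
    using residue_degree_dvd[OF f_min prime[OF that] d_int gs(1,3)[OF that]] res[OF that] p_def by simp
  \<comment> \<open>Needed for positive exponents: h = 0 would make R/P_i trivial and put 1 into
    P_i.\<close>
  have "h \<noteq> 0" if "i < g" for i
  proof
    assume "h = 0"
    then have "card (cosets ?R (P i)) = 1" using res[OF that] by (simp add: sub_index_def)
    then obtain K where K: "cosets ?R (P i) = {K}" by (rule card_1_singletonE)
    have "0 \<in> ?R" using ideal_OK[OF f_min ideal[OF that]] add_subgroup_zero by blast
    then have "{y. y - 1 \<in> P i} \<in> cosets ?R (P i)" "{y. y - 0 \<in> P i} \<in> cosets ?R (P i)"
      using one unfolding cosets_def by (blast intro: imageI)+
    then have "{y. y - 1 \<in> P i} = {y. y - 0 \<in> P i}" unfolding K singleton_iff by (simp only:)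
    then have "1 - 0 \<in> P i"
      unfolding coset_eq_iff[OF ideal_OK_subgroup[OF f_min ideal[OF that]]] .
    then show False using primeideal_OK(2)[OF f_min prime[OF that]] by simp
  qed
  \<comment> \<open>\<open>es i\<close> is the degree of the residue field of P_i over the subfield
    generated by the class of d.\<close>
  define es where "es i = h div degree (gs i)" for i
  have es: "es i * degree (gs i) = h" if "i < g" for i using gs_dvd[OF that] by (simp add: es_def)
  have es_pos: "es i \<ge> 1" if "i < g" for i
    using es[OF that] \<open>i < g \<Longrightarrow> h \<noteq> 0\<close> that by (cases "es i") auto
  define F where "F = (\<Prod>i<g. gs i ^ es i) ^ e"
  have gs0: "gs i \<noteq> 0" if "i < g" for i using gs(1)[OF that] by auto
  have F0: "F \<noteq> 0" using gs0 by (auto simp: F_def)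
  have lcF: "lead_coeff F = 1"
    using gs(2) by (simp add: F_def lead_coeff_power lead_coeff_prod)
  have lcf: "lead_coeff (red f :: 'p mod_ring poly) = 1" by (rule monic_red(1)[OF lc])
  have f0: "red f \<noteq> (0 :: 'p mod_ring poly)" using lcf by (metis leading_coeff_0_iff zero_neq_one)
  have mult: "multiplicity q (red f) = multiplicity q F" if q: "prime q" for q
  proof -
    have irr: "irreducible q" using q by (simp add: prime_def prime_elem_imp_irreducible)
    let ?S = "prime_complement d q"
    note S = submonoid_prime_complement[OF irr, of d]
    have SR: "?S \<subseteq> ?R"
      using prime_complement_subset[of d q] int_adjoin_subset_ring_of_integers[OF f_min d_int] by blast
    \<comment> \<open>The integer polynomials whose value at d lies in P_i are those whose reduction
      is a multiple of \<open>gs i\<close>. They avoid the denominators exactly if q divides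
      \<open>gs i\<close>, and monic irreducible polynomials dividing each other are equal.\<close>
    have disj: "?S \<inter> P i = {} \<longleftrightarrow> q = gs i" if "i < g" for i
    proof
      assume "q = gs i"
      then show "?S \<inter> P i = {}" using gs(3)[OF that] by (auto simp: prime_complement_def)
    next
      assume disj: "?S \<inter> P i = {}"
      obtain y where y: "gs i = red y" using surj_red by blast
      have "ieval y d \<in> P i" using gs(3)[OF that] y by simp
      then have "ieval y d \<notin> ?S" using disj by blast
      then have "q dvd gs i" unfolding y prime_complement_def by blast
      then show "q = gs i" using primes_dvd_imp_eq[OF q gs_prime[OF that]] by blast
    qed
    \<comment> \<open>The prime P_i contributes p^h to the localized index if it survives the
      localization, and 1 = p^0 if it does not.\<close>
    define k where "k i = (if q = gs i then h else 0)" for i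
    have "loc_index_factor d (of_nat p) ?S (P i) (p ^ k i)" if "i < g" for i
      using loc_index_factor_prime[OF f_min prime[OF that] fin[OF that] p0 S SR]
        disj[OF that] res[OF that] by (simp add: k_def split: if_splits)
    then have "loc_index_factor d (of_nat p) ?S (ideal_pow ?O (ideal_prod_list ?O P g) e) ((\<Prod>i<g. p ^ k i) ^ e)"
      by (intro loc_index_factor_pow[OF f_min S SR] loc_index_factor_prod_list[OF f_min S SR])
    then have "sub_index (loc ?S ?R) (loc ?S ((*) (of_nat p) ` ?R)) = (\<Prod>i<g. p ^ k i) ^ e"
      using sub_index_loc_principal[OF f_min] PIdl by metis
    moreover have "sub_index (loc ?S ?R) (loc ?S ((*) (of_nat p) ` ?R)) = p ^ (degree q * multiplicity q (red f))"
      using sub_index_loc_ring_of_integers[OF f_min d_int _ S prime_complement_subset, of p]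
        sub_index_loc_int_adjoin[OF f_min irr] p1 by (simp add: p_def)
    moreover have "(\<Prod>i<g. p ^ k i) ^ e = p ^ (e * (\<Sum>i<g. k i))"
      by (subst mult.commute) (simp only: power_sum power_mult)
    ultimately have "p ^ (degree q * multiplicity q (red f)) = p ^ (e * (\<Sum>i<g. k i))"
      by (simp only:)
    then have deg: "degree q * multiplicity q (red f) = e * (\<Sum>i<g. k i)"
      using p1 by (simp add: power_inject_exp)
    have q': "prime_elem q" using q by simp
    have "multiplicity q (gs i ^ es i) = (if q = gs i then es i else 0)" if "i < g" for i
      using q gs_prime[OF that] multiplicity_distinct_prime_power multiplicity_prime_power[of q] by auto
    moreover have "multiplicity q F = e * (\<Sum>i<g. multiplicity q (gs i ^ es i))"
      unfolding F_def using gs0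
      by (subst prime_elem_multiplicity_power_distrib[OF q'], simp)
        (subst prime_elem_multiplicity_prod_distrib[OF q'], auto)
    ultimately have "multiplicity q F = e * (\<Sum>i<g. if q = gs i then es i else 0)"
      by simp
    \<comment> \<open>Multiplying by deg q avoids division: where q = \<open>gs i\<close>, the
      product of deg q and \<open>es i\<close> is h, so both multiplicities are compared through the
      exponents \<open>k i\<close>.\<close>
    then have "degree q * multiplicity q F = e * (\<Sum>i<g. degree q * (if q = gs i then es i else 0))"
      by (simp add: sum_distrib_left mult.left_commute)
    also have "(\<Sum>i<g. degree q * (if q = gs i then es i else 0)) = (\<Sum>i<g. k i)"
      by (rule sum.cong) (auto simp: k_def es mult.commute)
    finally have "degree q * multiplicity q F = degree q * multiplicity q (red f)" by (simp add: deg)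
    moreover have "degree q \<noteq> 0"
      using irreducible_not_unit[OF irr] irr by (auto simp: is_unit_iff_degree)
    ultimately show ?thesis by simp
  qed
  \<comment> \<open>Equal multiplicities at all primes give equality up to a unit; both polynomials
    are monic, so the unit is 1.\<close>
  have "normalize (red f) = normalize F" by (rule multiplicity_eq_imp_eq[OF f0 F0 mult])
  then have "red f = F" using normalize_monic[OF lcf] normalize_monic[OF lcF] by simp
  moreover have "degree (gs i ^ es i) = h" if "i < g" for i
    using es[OF that] gs0[OF that] by (simp add: degree_power_eq mult.commute)
  ultimately show ?thesis
    using gs(1) es_pos by (intro exI[of _ "\<lambda>i. gs i ^ es i"] exI[of _ gs] exI[of _ es]) (auto simp: F_def)
qed

end
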